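(* Let $G$ be a finite connected graph without multiple edges and with at most one loop at each vertex. Let $L(G)$ be its set of loops, $n=|V(G)|$, $m_1=|L(G)|$, $m_0=|E(G)|-m_1$, $m'=2m_0+m_1=|D(G)|$, and $G'=(V(G),E(G)\setminus L(G))$. Let $q:D(G)\to\mathbb{H}\setminus\{0\}$ satisfy $\sum_{e\in D(G),\,o(e)=u}|q(e)|^2=1$ for every $u\in V(G)$, and let $\mathbf{U}$ be the transition matrix of the quaternionic Szegedy walk and $\tilde{\mathbf{W}}$ the doubly weighted matrix determined by $q$ (defined in the context). For a complex square matrix $\mathbf{A}$ let $\operatorname{Spec}(\mathbf{A})$ be the multiset of its eigenvalues counted with (algebraic) multiplicity. Then each $\mu\in\operatorname{Spec}(\psi(\tilde{\mathbf{W}}))$ is real with $-2\le\mu\le 2$. Let $\Lambda$ be the multiset of $4n$ elements $$\Lambda=\Big\{\tfrac{\mu}{2}\pm i\sqrt{1-\big(\tfrac{\mu}{2}\big)^2}\ :\ \mu\in\operatorname{Spec}(\psi(\tilde{\mathbf{W}}))\Big\},$$ where each $\mu$ (counted with multiplicity) contributes two elements, one for each sign. The multiset $\operatorname{Spec}(\psi(\mathbf{U}))$ has $2m'$ elements, and: 1. If $G'$ is not a tree, then $4n$ of the elements of $\operatorname{Spec}(\psi(\mathbf{U}))$ are those of $\Lambda$, and the remaining $2m'-4n$ are equal to $1$ with multiplicity $2m_0-2n$ and to $-1$ with multiplicity $2m_0+2m_1-2n$. 2. If $G'$ is a tree and $G$ has no loop, then $\operatorname{Spec}(\psi(\mathbf{U}))=\Lambda-\{1,1,-1,-1\}$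 (multiset difference). 3. If $G'$ is a tree and $G$ has at least one loop, then $\operatorname{Spec}(\psi(\mathbf{U}))=\big[\Lambda-\{1,1\}\big]\cup\{\underbrace{-1,\ldots,-1}_{2m_1-2}\}$ (multiset difference and multiset union). Moreover, the elements of $\operatorname{Spec}(\psi(\mathbf{U}))$ occur in complex conjugate pairs $\lambda_1,\overline{\lambda_1},\ldots,\lambda_{m'},\overline{\lambda_{m'}}$, and the set of right eigenvalues of $\mathbf{U}$ is $$\sigma_r(\mathbf{U})=\bigcup_{r=1}^{m'}\lambda_r^{\mathbb{H}^*}.$$
   Context: $\mathbb{H}$ denotes the real quaternions with basis $1,i,j,k$, $\mathbb{H}^*=\mathbb{H}\setminus\{0\}$, $x^*$ the quaternionic conjugate of $x$, $|x|=\sqrt{xx^*}$; complex numbers are regarded as the quaternions $x_0+x_1i$. Every quaternionic $p\times p$ matrix can be written uniquely as $\mathbf{M}=\mathbf{A}+j\mathbf{B}$ with complex matrices $\mathbf{A},\mathbf{B}$, and $\psi(\mathbf{M})=\begin{pmatrix}\mathbf{A}&-\overline{\mathbf{B}}\\ \mathbf{B}&\overline{\mathbf{A}}\end{pmatrix}$, a complex $2p\times2p$ matrix. A quaternion $\lambda$ is a right eigenvalue of $\mathbf{M}$ if $\mathbf{M}\mathbf{v}=\mathbf{v}\lambda$ for some nonzero $\mathbf{v}\in\mathbb{H}^p$; $\sigma_r(\mathbf{M})$ is the set of all right eigenvalues of $\mathbf{M}$. For $\lambda\in\mathbb{H}$, $\lambda^{\mathbb{H}^*}=\{x^{-1}\lambda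 x : x\in\mathbb{H}^*\}$. Arcs: for each unoriented edge $uv$ of $G$, the ordered pairs $(u,v)$ and $(v,u)$ are arcs; $D(G)$ is the set of all arcs. For $e=(u,v)$, $o(e)=u$ is its origin, $t(e)=v$ its terminus, $e^{-1}=(v,u)$. A loop at $u$ gives exactly one arc $(u,u)$, so $e^{-1}=e$ if and only if $e$ is a loop. The transition matrix $\mathbf{U}=(\mathbf{U}_{ef})_{e,f\in D(G)}$ is given by $\mathbf{U}_{ef}=2q(e)q(f^{-1})^*$ if $t(f)=o(e)$ and $f\ne e^{-1}$; $\mathbf{U}_{ef}=2|q(e)|^2-1$ if $f=e^{-1}$; $\mathbf{U}_{ef}=0$ otherwise. The doubly weighted matrix $\tilde{\mathbf{W}}=(\tilde{\mathbf{W}}_{uv})_{u,v\in V(G)}$ is given by $\tilde{\mathbf{W}}_{uv}=2q((u,v))^*q((v,u))$ if $(v,u)\in D(G)$, and $0$ otherwise. *)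

theory Defs
  imports
    "HOL-Analysis.Inner_Product"
    "HOL-Computational_Algebra.Computational_Algebra"
    "Graph_Theory.Graph_Theory"
    "Jordan_Normal_Form.Char_Poly"
begin

section \<open>Quaternions\<close>

datatype quat = Quat (Re0: real) (Im1: real) (Im2: real) (Im3: real)

lemma quat_eq_iff: "x = y \<longleftrightarrow> Re0 x = Re0 y \<and> Im1 x = Im1 y \<and> Im2 x = Im2 y \<and> Im3 x = Im3 y"
  by (cases x; cases y) simp

instantiation quat :: ring_1
begin
definition "0 = Quat 0 0 0 0"
definition "1 = Quat 1 0 0 0"
definition "x + y = Quat (Re0 x + Re0 y) (Im1 x + Im1 y) (Im2 x + Im2 y) (Im3 x + Im3 y)"
definition "- x = Quat (- Re0 x) (- Im1 x) (- Im2 x) (- Im3 x)"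
definition "x - y = Quat (Re0 x - Re0 y) (Im1 x - Im1 y) (Im2 x - Im2 y) (Im3 x - Im3 y)"
definition "x * y = Quat
  (Re0 x * Re0 y - Im1 x * Im1 y - Im2 x * Im2 y - Im3 x * Im3 y)
  (Re0 x * Im1 y + Im1 x * Re0 y + Im2 x * Im3 y - Im3 x * Im2 y)
  (Re0 x * Im2 y - Im1 x * Im3 y + Im2 x * Re0 y + Im3 x * Im1 y)
  (Re0 x * Im3 y + Im1 x * Im2 y - Im2 x * Im1 y + Im3 x * Re0 y)"
instance
  by standard (simp_all add: zero_quat_def one_quat_def plus_quat_def uminus_quat_def
      minus_quat_def times_quat_def algebra_simps)
end

lemma quat_sel [simp]:
  "Re0 0 = 0" "Im1 0 = 0" "Im2 0 = 0" "Im3 0 = 0"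
  "Re0 1 = 1" "Im1 1 = 0" "Im2 1 = 0" "Im3 1 = 0"
  "Re0 (x + y) = Re0 x + Re0 y" "Im1 (x + y) = Im1 x + Im1 y"
  "Im2 (x + y) = Im2 x + Im2 y" "Im3 (x + y) = Im3 x + Im3 y"
  "Re0 (- x) = - Re0 x" "Im1 (- x) = - Im1 x" "Im2 (- x) = - Im2 x" "Im3 (- x) = - Im3 x"
  "Re0 (x - y) = Re0 x - Re0 y" "Im1 (x - y) = Im1 x - Im1 y"
  "Im2 (x - y) = Im2 x - Im2 y" "Im3 (x - y) = Im3 x - Im3 y"
  by (simp_all add: zero_quat_def one_quat_def plus_quat_def uminus_quat_def minus_quat_def)

lemma quat_times_sel:
  "Re0 (x * y) = Re0 x * Re0 y - Im1 x * Im1 y - Im2 x * Im2 y - Im3 x * Im3 y"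
  "Im1 (x * y) = Re0 x * Im1 y + Im1 x * Re0 y + Im2 x * Im3 y - Im3 x * Im2 y"
  "Im2 (x * y) = Re0 x * Im2 y - Im1 x * Im3 y + Im2 x * Re0 y + Im3 x * Im1 y"
  "Im3 (x * y) = Re0 x * Im3 y + Im1 x * Im2 y - Im2 x * Im1 y + Im3 x * Re0 y"
  by (simp_all add: times_quat_def)

instantiation quat :: real_algebra_1
begin
definition "r *\<^sub>R x = Quat (r * Re0 x) (r * Im1 x) (r * Im2 x) (r * Im3 x)"
instance
  by standard (simp_all add: scaleR_quat_def quat_eq_iff quat_times_sel algebra_simps)
end

lemma quat_scaleR_sel [simp]:
  "Re0 (r *\<^sub>R x) = r * Re0 x" "Im1 (r *\<^sub>R x) = r * Im1 x"
  "Im2 (r *\<^sub>R x) = r * Im2 x" "Im3 (r *\<^sub>R x) = r * Im3 x"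
  by (simp_all add: scaleR_quat_def)

definition quat_cnj :: "quat \<Rightarrow> quat" where
  "quat_cnj x = Quat (Re0 x) (- Im1 x) (- Im2 x) (- Im3 x)"

instantiation quat :: real_inner
begin
definition "inner x y = Re0 x * Re0 y + Im1 x * Im1 y + Im2 x * Im2 y + Im3 x * Im3 y"
definition "norm (x :: quat) = sqrt (inner x x)"
definition "sgn (x :: quat) = x /\<^sub>R norm x"
definition "dist (x :: quat) y = norm (x - y)"
definition "uniformity = (INF e\<in>{0<..}. principal {(x :: quat, y). dist x y < e})"
definition "open (U :: quat set) \<longleftrightarrow>
  (\<forall>x\<in>U. eventually (\<lambda>(x', y). x' = x \<longrightarrow> y \<in> U) uniformity)"
instance
proof
  fix x y z :: quat and r :: real and U :: "quat set"
  show "inner x x = 0 \<longleftrightarrow> x = 0"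
  proof
    assume "inner x x = 0"
    then have "(Re0 x)\<^sup>2 + (Im1 x)\<^sup>2 + (Im2 x)\<^sup>2 + (Im3 x)\<^sup>2 = 0"
      by (simp add: inner_quat_def power2_eq_square)
    then show "x = 0"
      by (simp add: quat_eq_iff add_nonneg_eq_0_iff)
  qed (simp add: inner_quat_def)
qed (simp_all add: inner_quat_def norm_quat_def sgn_quat_def dist_quat_def uniformity_quat_def
      open_quat_def algebra_simps)
end

instantiation quat :: real_normed_div_algebra
begin
definition "inverse (x :: quat) = quat_cnj x /\<^sub>R inner x x"
definition "(x :: quat) div y = x * inverse y"
instance
proof
  fix x y :: quat
  have *: "inner x x = Re0 x * Re0 x + Im1 x * Im1 x + Im2 x * Im2 x + Im3 x * Im3 x" for x :: quat
    by (simp add: inner_quat_def)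
  show "norm (x * y) = norm x * norm y"
    by (simp add: norm_quat_def real_sqrt_mult[symmetric] * quat_times_sel) (simp add: algebra_simps)
  show "inverse (0 :: quat) = 0"
    by (simp add: inverse_quat_def)
  assume "x \<noteq> 0"
  then have nz: "inner x x \<noteq> 0" by simp
  have "quat_cnj x * x = inner x x *\<^sub>R 1" "x * quat_cnj x = inner x x *\<^sub>R 1"
    by (simp_all add: quat_eq_iff quat_times_sel quat_cnj_def inner_quat_def)
  with nz show "inverse x * x = 1" "x * inverse x = 1"
    by (simp_all add: inverse_quat_def)
qed (simp add: divide_quat_def)
end

lemma quat_mult_cnj: "x * quat_cnj x = of_real ((norm x)\<^sup>2)"
  by (simp add: norm_eq_sqrt_inner of_real_def quat_eq_iff quat_times_sel quat_cnj_def
      inner_quat_def)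

definition quat_j :: quat where
  "quat_j = Quat 0 0 1 0"

definition quat_of_complex :: "complex \<Rightarrow> quat" where
  "quat_of_complex z = Quat (Re z) (Im z) 0 0"

text \<open>
  The complex numbers \<open>a\<close>, \<open>b\<close> in the decomposition \<open>x = a + j b\<close>. The minus sign in the second
  component comes from \<open>j i = - k\<close>.
\<close>

definition simplex_part :: "quat \<Rightarrow> complex" where
  "simplex_part x = Complex (Re0 x) (Im1 x)"

definition perplex_part :: "quat \<Rightarrow> complex" where
  "perplex_part x = Complex (Im2 x) (- Im3 x)"

lemma quat_symplectic_iff:
  "x = quat_of_complex a + quat_j * quat_of_complex b
     \<longleftrightarrow> a = simplex_part x \<and> b = perplex_part x"
  by (auto simp: quat_eq_iff complex_eq_iff quat_times_sel quat_of_complex_def quat_j_def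
      simplex_part_def perplex_part_def)

definition quat_class :: "quat \<Rightarrow> quat set" where
  "quat_class l = {inverse x * l * x |x. x \<noteq> 0}"

section \<open>Matrices\<close>

text \<open>
  Matrices whose rows and columns are indexed by a finite set are turned into matrices of the
  library by means of an enumeration \<open>xs\<close> (a distinct list) of the index set.
\<close>

definition mat_on :: "'i list \<Rightarrow> ('i \<Rightarrow> 'i \<Rightarrow> 'a) \<Rightarrow> 'a mat" where
  "mat_on xs M = mat (length xs) (length xs) (\<lambda>(i, j). M (xs ! i) (xs ! j))"

definition psi :: "quat mat \<Rightarrow> complex mat" where
  "psi M = (let A = map_mat simplex_part M; B = map_mat perplex_part M
            in four_block_mat A (- map_mat cnj B) B (map_mat cnj A))"

definition Spec :: "complex mat \<Rightarrow> complex multiset" where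
  "Spec A = proots (char_poly A)"

text \<open>Scalars act on vectors from the right, so the library's \<open>\<cdot>\<^sub>v\<close> cannot be used here.\<close>

definition right_eigenvalue :: "quat mat \<Rightarrow> quat \<Rightarrow> bool" where
  "right_eigenvalue M l \<longleftrightarrow>
     (\<exists>v \<in> carrier_vec (dim_row M). v \<noteq> 0\<^sub>v (dim_row M) \<and> M *\<^sub>v v = map_vec (\<lambda>x. x * l) v)"

definition right_spectrum :: "quat mat \<Rightarrow> quat set" where
  "right_spectrum M = {l. right_eigenvalue M l}"

section \<open>Graphs\<close>

text \<open>
  A finite graph without multiple edges and with at most one loop at each vertex is a
  \<^locale>\<open>pair_pseudo_graph\<close>, given by its vertices and its symmetric set \<open>parcs G\<close> of arcs
  \<open>(u, v)\<close>. A loop at \<open>u\<close> is the single arc \<open>(u, u)\<close>. Unoriented edges are the sets \<open>{u, v}\<close>.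
\<close>

definition edge_set :: "'v pair_pre_digraph \<Rightarrow> 'v set set" where
  "edge_set G = {{u, v} |u v. (u, v) \<in> parcs G}"

definition loop_set :: "'v pair_pre_digraph \<Rightarrow> 'v set set" where
  "loop_set G = {{u} |u. (u, u) \<in> parcs G}"

definition remove_loops :: "'v pair_pre_digraph \<Rightarrow> 'v pair_pre_digraph" where
  "remove_loops G = G\<lparr>parcs := {(u, v) \<in> parcs G. u \<noteq> v}\<rparr>"

text \<open>
  The library predicate \<^const>\<open>tree\<close> cannot be used for symmetric digraphs, because it counts
  going back and forth along an edge as a cycle. For a simple graph a cycle has length at least 3.
\<close>

definition undirected_tree :: "'v pair_pre_digraph \<Rightarrow> bool" where
  "undirected_tree G \<longleftrightarrow> connected (with_proj G) \<and>
     \<not> (\<exists>p. pre_digraph.cycle (with_proj G) p \<and> 3 \<le> length p)"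

section \<open>The quaternionic Szegedy walk\<close>

text \<open>
  The origin and the terminus of an arc \<open>e\<close> are \<open>fst e\<close> and \<open>snd e\<close>, and \<open>e\<^sup>-\<^sup>1\<close> is
  \<open>prod.swap e\<close>. If \<open>f = prod.swap e\<close> then also \<open>snd f = fst e\<close>.
\<close>

definition transition_entry :: "('v \<times> 'v \<Rightarrow> quat) \<Rightarrow> 'v \<times> 'v \<Rightarrow> 'v \<times> 'v \<Rightarrow> quat" where
  "transition_entry q e f =
     (if f = prod.swap e then of_real (2 * (norm (q e))\<^sup>2 - 1)
      else if snd f = fst e then 2 * q e * quat_cnj (q (prod.swap f))
      else 0)"

definition doubly_weighted_entry ::
    "'v pair_pre_digraph \<Rightarrow> ('v \<times> 'v \<Rightarrow> quat) \<Rightarrow> 'v \<Rightarrow> 'v \<Rightarrow> quat" where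
  "doubly_weighted_entry G q u v =
     (if (v, u) \<in> parcs G then 2 * quat_cnj (q (u, v)) * q (v, u) else 0)"

text \<open>
  On the interval \<open>[-2, 2]\<close>, where the function is used, \<^const>\<open>csqrt\<close> is the ordinary square root
  of a nonnegative real number.
\<close>

definition spectral_lift :: "complex multiset \<Rightarrow> complex multiset" where
  "spectral_lift S =
     (\<Sum>\<mu>\<in>#S. {#\<mu> / 2 + \<i> * csqrt (1 - (\<mu> / 2)\<^sup>2), \<mu> / 2 - \<i> * csqrt (1 - (\<mu> / 2)\<^sup>2)#})"

end

theory Submission
  imports Defs
begin

text \<open>
  Let \<open>K\<close> be the matrix with entries \<open>K e u = q e\<close> for \<open>o(e) = u\<close> and \<open>0\<close> otherwise, and \<open>S\<close> the
  permutation matrix of \<open>e \<mapsto> e\<^sup>-\<^sup>1\<close>. The normalisation of \<open>q\<close> says \<open>K\<^sup>* K = 1\<close>, and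
  \<open>U = (2 K K\<^sup>* - 1) S\<close>, \<open>W = 2 K\<^sup>* S K\<close>. As \<open>psi\<close> is multiplicative, Sylvester's determinant
  identity gives \<open>det (x - U) (x\<^sup>2 - 1)\<^bsup>2n\<^esup> = det (x + S) det (x\<^sup>2 + 1 - x W)\<close> for the complex
  representations, hence
  \<open>Spec U + 2n{1} + 2n{-1} = \<Lambda> + 2m\<^sub>0{1} + (2m\<^sub>0 + 2m\<^sub>1){-1}\<close>. The three cases follow by
  cancellation, because \<open>m\<^sub>0 = n - 1\<close> if \<open>G'\<close> is a tree and \<open>m\<^sub>0 \<ge> n\<close> otherwise. The same identity
  shows that the real elements of \<open>Spec U\<close> have even multiplicity. The right eigenvalues are found
  from the complex ones among them, since every quaternion is conjugate to a complex number.
\<close>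

section \<open>Determinants and characteristic polynomials\<close>

text \<open>Sylvester's identity with denominators cleared: \<open>Q\<close> is \<open>c\<close>
  times the inverse of \<open>P\<close>, and the power of \<open>c\<close> keeps the statement
  inside the ring. Both sides are found by evaluating the determinant of one block matrix
  \<open>B\<close> in two ways.\<close>

lemma det_mult_smult_one_minus:
  fixes c :: "'a :: idom"
  assumes X: "X \<in> carrier_mat N k" and Y: "Y \<in> carrier_mat k N"
    and P: "P \<in> carrier_mat N N" and Q: "Q \<in> carrier_mat N N"
    and PQ: "P * Q = c \<cdot>\<^sub>m 1\<^sub>m N" and c: "c \<noteq> 0"
  shows "det (P - X * Y) * c ^ k = det P * det (c \<cdot>\<^sub>m 1\<^sub>m k - Y * Q * X)"
proof -
  have YQ: "Y * Q \<in> carrier_mat k N" and QX: "Q * X \<in> carrier_mat N k"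
    and XY: "X * Y \<in> carrier_mat N N"
    using X Y Q by auto
  define B where "B = four_block_mat P X Y (1\<^sub>m k)"
  have B: "B \<in> carrier_mat (N + k) (N + k)"
    using P by (auto simp: B_def)
  have dPQ: "det P * det Q = c ^ N"
    using det_mult[OF P Q] by (simp add: PQ)
  then have dQ: "det Q \<noteq> 0"
    using c by (metis mult_zero_right power_not_zero)
  \<comment> \<open>This unitriangular factor clears the block \<open>Y\<close> and leaves the Schur
    complement \<open>P - X * Y\<close>.\<close>
  let ?L = "four_block_mat (1\<^sub>m N) (0\<^sub>m N k) (- Y) (1\<^sub>m k)"
  have "B * ?L = four_block_mat (P - X * Y) X (0\<^sub>m k N) (1\<^sub>m k)"
    unfolding B_def
    by (subst mult_four_block_mat[OF P X Y one_carrier_mat one_carrier_mat zero_carrier_mat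
          uminus_carrier_mat[OF Y] one_carrier_mat], rule cong_four_block_mat)
      (use P X Y XY in \<open>auto simp: minus_add_uminus_mat\<close>)
  then have "det B * det ?L = det (P - X * Y) * det (1\<^sub>m k :: 'a mat)"
    by (subst det_mult[OF B, symmetric])
      (use X Y P XY in \<open>auto simp: det_four_block_mat_lower_left_zero[OF minus_carrier_mat[OF XY] X refl one_carrier_mat]\<close>)
  moreover have "det ?L = 1"
    using Y by (subst det_four_block_mat_upper_right_zero[of _ N _ k]) auto
  ultimately have 1: "det B = det (P - X * Y)"
    by simp
  \<comment> \<open>This factor clears the block \<open>X\<close> instead. The corner
    \<open>c\<close> in place of \<open>1\<close> avoids division, since \<open>P * Q\<close> is
    only a multiple of the identity.\<close>
  let ?R = "four_block_mat Q (- (Q * X)) (0\<^sub>m k N) (c \<cdot>\<^sub>m 1\<^sub>m k)"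
  have PQX: "P * - (Q * X) = - (c \<cdot>\<^sub>m X)"
    using P Q X QX assoc_mult_mat[OF P Q X]
    by (simp add: PQ mult_smult_assoc_mat[OF one_carrier_mat X])
  have YQX: "Y * - (Q * X) = - (Y * Q * X)"
    using Y Q X QX assoc_mult_mat[OF Y Q X] by simp
  have YQX': "Y * Q * X \<in> carrier_mat k k"
    using YQ X by auto
  have blocks: "P * Q + X * 0\<^sub>m k N = c \<cdot>\<^sub>m 1\<^sub>m N" "P * - (Q * X) + X * (c \<cdot>\<^sub>m 1\<^sub>m k) = 0\<^sub>m N k"
    "Y * Q + 1\<^sub>m k * 0\<^sub>m k N = Y * Q"
    "Y * - (Q * X) + 1\<^sub>m k * (c \<cdot>\<^sub>m 1\<^sub>m k) = c \<cdot>\<^sub>m 1\<^sub>m k - Y * Q * X"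
    unfolding PQ PQX YQX mult_smult_distrib[OF X one_carrier_mat] right_mult_one_mat[OF X]
      right_mult_zero_mat[OF X] right_mult_zero_mat[OF one_carrier_mat]
      left_mult_one_mat[OF smult_carrier_mat[OF one_carrier_mat]]
    using X YQ YQX' by (auto simp del: index_mult_mat(1) intro!: eq_matI)
  have "B * ?R = four_block_mat (c \<cdot>\<^sub>m 1\<^sub>m N) (0\<^sub>m N k) (Y * Q) (c \<cdot>\<^sub>m 1\<^sub>m k - Y * Q * X)"
    unfolding B_def
    by (subst mult_four_block_mat[OF P X Y one_carrier_mat Q uminus_carrier_mat[OF QX]
          zero_carrier_mat smult_carrier_mat[OF one_carrier_mat]]) (simp only: blocks)
  moreover have "det (B * ?R) = det B * det ?R"
    using Q by (intro det_mult[OF B]) auto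
  moreover have "det (four_block_mat (c \<cdot>\<^sub>m 1\<^sub>m N) (0\<^sub>m N k) (Y * Q) (c \<cdot>\<^sub>m 1\<^sub>m k - Y * Q * X))
      = det (c \<cdot>\<^sub>m 1\<^sub>m N :: 'a mat) * det (c \<cdot>\<^sub>m 1\<^sub>m k - Y * Q * X)"
    by (rule det_four_block_mat_upper_right_zero[OF _ refl YQ minus_carrier_mat[OF YQX']]) auto
  moreover have "det ?R = det Q * c ^ k"
    using Q X by (subst det_four_block_mat_lower_left_zero[of _ N _ k]) auto
  ultimately have "det (P - X * Y) * (det Q * c ^ k) = c ^ N * det (c \<cdot>\<^sub>m 1\<^sub>m k - Y * Q * X)"
    by (simp add: 1)
  also have "\<dots> = det P * det Q * det (c \<cdot>\<^sub>m 1\<^sub>m k - Y * Q * X)"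
    by (simp add: dPQ)
  finally show ?thesis
    using dQ by simp
qed

section \<open>Spectra as multisets of roots\<close>

lemma poly_char_poly:
  fixes A :: "'a :: field mat"
  assumes "A \<in> carrier_mat n n"
  shows "poly (char_poly A) x = det (x \<cdot>\<^sub>m 1\<^sub>m n - A)"
proof -
  have "- char_matrix A x = x \<cdot>\<^sub>m 1\<^sub>m n - A"
    using assms by (intro eq_matI) (auto simp: char_matrix_def)
  then show ?thesis
    by (simp add: char_poly_matrix[OF assms])
qed

lemma proots_prod_mset_linear: "proots (\<Prod>a\<in>#M. [:- a, 1:]) = (M :: 'a :: idom multiset)"
proof (induction M)
  case (add a M)
  have "(\<Prod>a\<in>#M. [:- a, 1:]) \<noteq> 0"
    by (auto simp: prod_mset_zero_iff)
  then have "proots ([:- a, 1:] * (\<Prod>a\<in>#M. [:- a, 1:])) = {#a#} + M"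
    by (subst proots_mult) (simp_all add: add)
  then show ?case
    by (simp del: mult_pCons_left)
qed simp

lemma prod_mset_linear_proots:
  fixes p :: "complex poly"
  assumes "lead_coeff p = 1"
  shows "(\<Prod>a\<in>#proots p. [:- a, 1:]) = p"
proof -
  obtain as where "Polynomial.smult (lead_coeff p) (\<Prod>a\<leftarrow>as. [:- a, 1:]) = p"
    using fundamental_theorem_algebra_factorized by blast
  then have p: "p = (\<Prod>a\<leftarrow>as. [:- a, 1:])"
    using assms by simp
  have "p = (\<Prod>a\<in>#mset as. [:- a, 1:])"
    by (simp add: p flip: prod_mset_prod_list)
  then show ?thesis
    by (metis proots_prod_mset_linear)
qed

lemma size_Spec: "A \<in> carrier_mat n n \<Longrightarrow> size (Spec A) = n"
  using degree_monic_char_poly by (auto simp: Spec_def size_proots_complex)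

lemma det_smult_one_minus_Spec:
  assumes "A \<in> carrier_mat n n"
  shows "det (x \<cdot>\<^sub>m 1\<^sub>m n - A) = (\<Prod>a\<in>#Spec A. x - a)"
proof -
  have "lead_coeff (char_poly A) = 1"
    using degree_monic_char_poly[OF assms] by simp
  then have "(\<Prod>a\<in>#Spec A. [:- a, 1:]) = char_poly A"
    unfolding Spec_def by (rule prod_mset_linear_proots)
  then have "poly (char_poly A) x = poly (\<Prod>a\<in>#Spec A. [:- a, 1:]) x"
    by simp
  also have "\<dots> = (\<Prod>a\<in>#Spec A. x - a)"
    by (simp add: poly_prod_mset image_mset.compositionality comp_def)
  finally show ?thesis
    by (simp add: poly_char_poly[OF assms])
qed

lemma mem_Spec_iff:
  assumes "A \<in> carrier_mat n n"
  shows "z \<in># Spec A \<longleftrightarrow> eigenvalue A z"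
proof -
  have "char_poly A \<noteq> 0"
    using degree_monic_char_poly[OF assms] by auto
  then show ?thesis
    by (simp add: Spec_def eigenvalue_root_char_poly[OF assms])
qed

text \<open>The two monic polynomials agree at infinitely many points, hence coincide, and
  \<open>proots\<close> recovers the multisets. The finite set \<open>F\<close> makes room for
  points at which one cannot divide.\<close>

lemma multiset_eq_if_prod_diff_eq:
  fixes M N :: "'a :: {idom, ring_char_0} multiset"
  assumes "finite F" and eq: "\<And>x. x \<notin> F \<Longrightarrow> (\<Prod>a\<in>#M. x - a) = (\<Prod>a\<in>#N. x - a)"
  shows "M = N"
proof -
  let ?p = "\<lambda>M :: 'a multiset. \<Prod>a\<in>#M. [:- a, 1:]"
  have "poly (?p M - ?p N) x = 0" if "x \<notin> F" for x
    using eq[OF that] by (simp add: poly_prod_mset image_mset.compositionality comp_def)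
  then have "- F \<subseteq> {x. poly (?p M - ?p N) x = 0}"
    by auto
  moreover have "infinite (- F)"
    using \<open>finite F\<close> by (simp add: finite_compl infinite_UNIV_char_0)
  ultimately have "?p M - ?p N = 0"
    using poly_roots_finite finite_subset by blast
  then show ?thesis
    by (metis proots_prod_mset_linear eq_iff_diff_eq_0)
qed

text \<open>The two lifts of \<mu> have sum \<mu> and product 1, so they are the roots of
  \<open>x\<^sup>2 - \<mu> x + 1\<close>. This holds for every complex \<mu>, because
  \<open>csqrt\<close> always squares to its argument.\<close>

lemma prod_diff_spectral_lift:
  "(\<Prod>a\<in>#spectral_lift M. x - a) = (\<Prod>\<mu>\<in>#M. x\<^sup>2 + 1 - x * \<mu>)"
proof (induction M)
  case (add \<mu> M)
  define s where "s = csqrt (1 - (\<mu> / 2)\<^sup>2)"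
  have "s\<^sup>2 = 1 - (\<mu> / 2)\<^sup>2"
    by (simp add: s_def)
  then have "(x - (\<mu> / 2 + \<i> * s)) * (x - (\<mu> / 2 - \<i> * s)) = x\<^sup>2 + 1 - x * \<mu>"
    by (simp add: power2_eq_square field_simps)
  moreover have "spectral_lift (add_mset \<mu> M) = {#\<mu> / 2 + \<i> * s, \<mu> / 2 - \<i> * s#} + spectral_lift M"
    by (simp add: spectral_lift_def s_def)
  ultimately show ?case
    using add by (simp add: mult.assoc)
qed (simp add: spectral_lift_def)

text \<open>Pulling \<open>x\<close> out of the matrix leaves the characteristic polynomial of
  \<open>W\<close> at \<open>x + 1 / x\<close>; the \<open>k\<close> factors \<open>x\<close> are
  then shared out among the \<open>k\<close> eigenvalues.\<close>

lemma det_quadratic_Spec: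
  assumes W: "W \<in> carrier_mat k k" and x: "x \<noteq> 0"
  shows "det ((x\<^sup>2 + 1) \<cdot>\<^sub>m 1\<^sub>m k - x \<cdot>\<^sub>m W) = (\<Prod>\<mu>\<in>#Spec W. x\<^sup>2 + 1 - x * \<mu>)"
proof -
  let ?y = "(x\<^sup>2 + 1) / x"
  have "(x\<^sup>2 + 1) \<cdot>\<^sub>m 1\<^sub>m k - x \<cdot>\<^sub>m W = x \<cdot>\<^sub>m (?y \<cdot>\<^sub>m 1\<^sub>m k - W)"
    using W x by (intro eq_matI) (auto simp: field_simps)
  then have "det ((x\<^sup>2 + 1) \<cdot>\<^sub>m 1\<^sub>m k - x \<cdot>\<^sub>m W) = x ^ k * (\<Prod>\<mu>\<in>#Spec W. ?y - \<mu>)"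
    using W by (simp add: det_smult_one_minus_Spec)
  also have "x ^ k = (\<Prod>\<mu>\<in>#Spec W. x)"
    by (simp add: size_Spec[OF W])
  also have "(\<Prod>\<mu>\<in>#Spec W. x) * (\<Prod>\<mu>\<in>#Spec W. ?y - \<mu>) = (\<Prod>\<mu>\<in>#Spec W. x * (?y - \<mu>))"
    by (simp add: prod_mset.distrib)
  also have "\<dots> = (\<Prod>\<mu>\<in>#Spec W. x\<^sup>2 + 1 - x * \<mu>)"
    using x by (simp add: right_diff_distrib)
  finally show ?thesis .
qed

text \<open>
  The product \<open>(x + S) (x - S) = x\<^sup>2 - 1\<close> allows to eliminate the rank \<open>k\<close> term from
  \<open>x - U = (x + S) - X Y\<close>.
\<close>

lemma Spec_coined_walk:
  fixes S :: "complex mat"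
  assumes S: "S \<in> carrier_mat N N" and X: "X \<in> carrier_mat N k" and Y: "Y \<in> carrier_mat k N"
    and R: "R \<in> carrier_mat N l" and R': "R' \<in> carrier_mat l N"
    and S2: "S * S = 1\<^sub>m N" and YSX: "Y * S * X = 2 \<cdot>\<^sub>m 1\<^sub>m k"
    and SR: "S = 1\<^sub>m N - R * R'" and RR: "R' * R = 2 \<cdot>\<^sub>m 1\<^sub>m l"
  shows "Spec (X * Y - S) + replicate_mset k 1 + replicate_mset (k + l) (- 1)
    = spectral_lift (Spec (Y * X)) + replicate_mset l 1 + replicate_mset N (- 1)"
proof (rule multiset_eq_if_prod_diff_eq)
  show "finite {0, 1, - 1 :: complex}"
    by simp
  fix x :: complex
  \<comment> \<open>Zero is excluded because \<open>det_quadratic_Spec\<close> divides by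
    \<open>x\<close>, the other two because \<open>x\<^sup>2 - 1\<close> and \<open>x + 1\<close>
    take the role of \<open>c\<close> in \<open>det_mult_smult_one_minus\<close>.\<close>
  assume "x \<notin> {0, 1, - 1}"
  then have x: "x \<noteq> 0" "x + 1 \<noteq> 0" "x\<^sup>2 - 1 \<noteq> 0"
    by (auto simp: power2_eq_1_iff simp flip: eq_neg_iff_add_eq_0)
  have XY: "X * Y \<in> carrier_mat N N" and YX: "Y * X \<in> carrier_mat k k"
    and YS: "Y * S \<in> carrier_mat k N" and RR': "R * R' \<in> carrier_mat N N"
    using X Y S R R' by auto
  define P where "P = x \<cdot>\<^sub>m 1\<^sub>m N + S"
  define Q where "Q = x \<cdot>\<^sub>m 1\<^sub>m N - S"
  have P: "P \<in> carrier_mat N N" and Q: "Q \<in> carrier_mat N N"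
    using S by (auto simp: P_def Q_def)
  have "P * Q = x \<cdot>\<^sub>m 1\<^sub>m N * Q + S * Q"
    unfolding P_def using S Q by (intro add_mult_distrib_mat) auto
  also have "x \<cdot>\<^sub>m 1\<^sub>m N * Q = x \<cdot>\<^sub>m Q"
    using Q by auto
  also have "S * Q = S * (x \<cdot>\<^sub>m 1\<^sub>m N) - S * S"
    unfolding Q_def using S by (intro mult_minus_distrib_mat) auto
  also have "S * (x \<cdot>\<^sub>m 1\<^sub>m N) = x \<cdot>\<^sub>m S"
    using S by (auto simp: mult_smult_distrib)
  also have "x \<cdot>\<^sub>m Q + (x \<cdot>\<^sub>m S - S * S) = (x\<^sup>2 - 1) \<cdot>\<^sub>m 1\<^sub>m N"
    using S by (intro eq_matI) (auto simp: Q_def S2 power2_eq_square algebra_simps)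
  finally have PQ: "P * Q = (x\<^sup>2 - 1) \<cdot>\<^sub>m 1\<^sub>m N" .
  have "Y * Q = x \<cdot>\<^sub>m Y - Y * S"
    unfolding Q_def using Y S
    by (subst mult_minus_distrib_mat[of _ k N]) (auto simp: mult_smult_distrib)
  then have "Y * Q * X = x \<cdot>\<^sub>m (Y * X) - 2 \<cdot>\<^sub>m 1\<^sub>m k"
    using Y S X YS YX
    by (simp add: minus_mult_distrib_mat[of _ k N] YSX mult_smult_assoc_mat[OF Y X])
  then have "(x\<^sup>2 - 1) \<cdot>\<^sub>m 1\<^sub>m k - Y * Q * X = (x\<^sup>2 + 1) \<cdot>\<^sub>m 1\<^sub>m k - x \<cdot>\<^sub>m (Y * X)"
    using X Y YX by (intro eq_matI) (auto simp del: index_mult_mat(1))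
  then have "det (P - X * Y) * (x\<^sup>2 - 1) ^ k
      = det P * (\<Prod>\<mu>\<in>#Spec (Y * X). x\<^sup>2 + 1 - x * \<mu>)"
    using det_mult_smult_one_minus[OF X Y P Q PQ x(3)] by (simp add: det_quadratic_Spec[OF YX x(1)])
  also have "P - X * Y = x \<cdot>\<^sub>m 1\<^sub>m N - (X * Y - S)"
    using X Y XY S by (intro eq_matI) (auto simp: P_def)
  also have "det \<dots> = (\<Prod>a\<in>#Spec (X * Y - S). x - a)"
    using X Y XY S by (intro det_smult_one_minus_Spec) auto
  finally have 1: "(\<Prod>a\<in>#Spec (X * Y - S). x - a) * (x\<^sup>2 - 1) ^ k
      = det P * (\<Prod>a\<in>#spectral_lift (Spec (Y * X)). x - a)"
    by (simp add: prod_diff_spectral_lift)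
  \<comment> \<open>A second use of Sylvester's identity, now for the rank \<open>l\<close> term in
    \<open>S = 1 - R R'\<close>, computes the remaining factor \<open>det P\<close>.\<close>
  have "(x + 1) \<cdot>\<^sub>m 1\<^sub>m N - R * R' = P"
    using R R' RR' by (intro eq_matI) (auto simp: P_def SR)
  moreover have "(x + 1) \<cdot>\<^sub>m 1\<^sub>m l - R' * 1\<^sub>m N * R = (x - 1) \<cdot>\<^sub>m 1\<^sub>m l"
    using R R' by (intro eq_matI) (auto simp: RR)
  ultimately have 2: "det P * (x + 1) ^ l = (x + 1) ^ N * (x - 1) ^ l"
    using det_mult_smult_one_minus[OF R R', of "(x + 1) \<cdot>\<^sub>m 1\<^sub>m N" "1\<^sub>m N" "x + 1"] x by simp
  have "(\<Prod>a\<in>#Spec (X * Y - S). x - a) * (x - 1) ^ k * (x + 1) ^ (k + l)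
      = ((\<Prod>a\<in>#Spec (X * Y - S). x - a) * (x\<^sup>2 - 1) ^ k) * (x + 1) ^ l"
    by (simp add: power_add power_mult_distrib[symmetric] power2_eq_square algebra_simps)
  also have "\<dots> = (\<Prod>a\<in>#spectral_lift (Spec (Y * X)). x - a) * (det P * (x + 1) ^ l)"
    by (simp add: 1)
  also have "\<dots> = (\<Prod>a\<in>#spectral_lift (Spec (Y * X)). x - a) * (x - 1) ^ l * (x + 1) ^ N"
    by (simp add: 2)
  finally show "(\<Prod>a\<in>#Spec (X * Y - S) + replicate_mset k 1 + replicate_mset (k + l) (- 1). x - a)
    = (\<Prod>a\<in>#spectral_lift (Spec (Y * X)) + replicate_mset l 1 + replicate_mset N (- 1). x - a)"
    by simp
qed

section \<open>The complex representation of quaternionic matrices\<close>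

lemma simplex_part_simps [simp]:
  "simplex_part 0 = 0" "simplex_part 1 = 1" "simplex_part (of_real r) = of_real r"
  "simplex_part (x + y) = simplex_part x + simplex_part y"
  "simplex_part (x - y) = simplex_part x - simplex_part y"
  by (simp_all add: simplex_part_def complex_eq_iff of_real_def)

lemma perplex_part_simps [simp]:
  "perplex_part 0 = 0" "perplex_part 1 = 0" "perplex_part (of_real r) = 0"
  "perplex_part (x + y) = perplex_part x + perplex_part y"
  "perplex_part (x - y) = perplex_part x - perplex_part y"
  by (simp_all add: perplex_part_def complex_eq_iff of_real_def)

text \<open>The conjugate comes from moving a complex number past \<open>j\<close>:
  \<open>z j = j cnj z\<close>. The sign is that of \<open>j\<^sup>2 = - 1\<close>.\<close>

lemma simplex_part_mult:
  "simplex_part (x * y) = simplex_part x * simplex_part y - cnj (perplex_part x) * perplex_part y"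
  by (simp add: simplex_part_def perplex_part_def complex_eq_iff quat_times_sel)

lemma perplex_part_mult:
  "perplex_part (x * y) = perplex_part x * simplex_part y + cnj (simplex_part x) * perplex_part y"
  by (simp add: simplex_part_def perplex_part_def complex_eq_iff quat_times_sel)

lemma simplex_part_sum: "simplex_part (sum f A) = (\<Sum>x\<in>A. simplex_part (f x))"
  by (induction A rule: infinite_finite_induct) auto

lemma perplex_part_sum: "perplex_part (sum f A) = (\<Sum>x\<in>A. perplex_part (f x))"
  by (induction A rule: infinite_finite_induct) auto

lemma quat_eq_parts_iff:
  "x = y \<longleftrightarrow> simplex_part x = simplex_part y \<and> perplex_part x = perplex_part y"
  by (auto simp: quat_eq_iff simplex_part_def perplex_part_def)

lemma quat_of_complex_parts [simp]:
  "simplex_part (quat_of_complex z) = z" "perplex_part (quat_of_complex z) = 0"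
  by (auto simp: simplex_part_def perplex_part_def quat_of_complex_def complex_eq_iff)

lemma psi_carrier [simp]:
  "M \<in> carrier_mat nr nc \<Longrightarrow> psi M \<in> carrier_mat (nr + nr) (nc + nc)"
  by (auto simp: psi_def Let_def)

lemma psi_mult:
  assumes M: "M \<in> carrier_mat nr n" and N: "N \<in> carrier_mat n nc"
  shows "psi (M * N) = psi M * psi N"
proof -
  define A B where "A = map_mat simplex_part M" and "B = map_mat perplex_part M"
  define A' B' where "A' = map_mat simplex_part N" and "B' = map_mat perplex_part N"
  note defs = A_def B_def A'_def B'_def
  have carrier: "A \<in> carrier_mat nr n" "- map_mat cnj B \<in> carrier_mat nr n"
    "B \<in> carrier_mat nr n" "map_mat cnj A \<in> carrier_mat nr n"
    "A' \<in> carrier_mat n nc" "- map_mat cnj B' \<in> carrier_mat n nc"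
    "B' \<in> carrier_mat n nc" "map_mat cnj A' \<in> carrier_mat n nc"
    using M N by (auto simp: defs)
  note parts = simplex_part_sum simplex_part_mult perplex_part_sum perplex_part_mult scalar_prod_def
    sum_subtractf sum_negf sum.distrib
  have "map_mat simplex_part (M * N) = A * A' + - map_mat cnj B * B'"
    "- map_mat cnj (map_mat perplex_part (M * N)) = A * - map_mat cnj B' + - map_mat cnj B * map_mat cnj A'"
    "map_mat perplex_part (M * N) = B * A' + map_mat cnj A * B'"
    "map_mat cnj (map_mat simplex_part (M * N)) = B * - map_mat cnj B' + map_mat cnj A * map_mat cnj A'"
    using M N by (auto simp: defs parts intro!: eq_matI)
  then show ?thesis
    unfolding psi_def Let_def defs[symmetric]
    by (simp only: mult_four_block_mat[OF carrier])
qed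

lemma psi_minus:
  assumes "M \<in> carrier_mat nr nc" "N \<in> carrier_mat nr nc"
  shows "psi (M - N) = psi M - psi N"
  using assms by (intro eq_matI) (auto simp: psi_def Let_def)

lemma psi_smult_one: "psi (of_real r \<cdot>\<^sub>m 1\<^sub>m n) = of_real r \<cdot>\<^sub>m 1\<^sub>m (n + n)"
  by (intro eq_matI) (auto simp: psi_def Let_def simplex_part_mult perplex_part_mult)

lemma psi_one: "psi (1\<^sub>m n) = 1\<^sub>m (n + n)"
  by (intro eq_matI) (auto simp: psi_def Let_def)

section \<open>Right eigenvalues and similarity classes\<close>

definition psi_vec :: "quat vec \<Rightarrow> complex vec" where
  "psi_vec v = map_vec simplex_part v @\<^sub>v map_vec perplex_part v"

lemma psi_vec_carrier [simp]: "v \<in> carrier_vec n \<Longrightarrow> psi_vec v \<in> carrier_vec (n + n)"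
  by (auto simp: psi_vec_def)

lemma psi_vec_zero: "psi_vec (0\<^sub>v n) = 0\<^sub>v (n + n)"
  by (intro eq_vecI) (auto simp: psi_vec_def)

lemma psi_vec_inj:
  assumes "v \<in> carrier_vec n" "w \<in> carrier_vec n" "psi_vec v = psi_vec w"
  shows "v = w"
proof (rule eq_vecI)
  fix i assume i: "i < dim_vec w"
  have "psi_vec v $ i = psi_vec w $ i" "psi_vec v $ (n + i) = psi_vec w $ (n + i)"
    using assms(3) by simp_all
  then show "v $ i = w $ i"
    using assms(1,2) i by (auto simp: psi_vec_def quat_eq_parts_iff)
qed (use assms in auto)

lemma psi_vec_surj:
  assumes "w \<in> carrier_vec (n + n)"
  obtains v where "v \<in> carrier_vec n" "psi_vec v = w"
proof
  let ?v = "vec n (\<lambda>i. quat_of_complex (w $ i) + quat_j * quat_of_complex (w $ (n + i)))"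
  have parts: "simplex_part (quat_of_complex a + quat_j * quat_of_complex b) = a"
    "perplex_part (quat_of_complex a + quat_j * quat_of_complex b) = b" for a b
    using quat_symplectic_iff[of "quat_of_complex a + quat_j * quat_of_complex b" a b] by simp_all
  show "?v \<in> carrier_vec n"
    by simp
  show "psi_vec ?v = w"
    using assms by (intro eq_vecI) (auto simp: psi_vec_def parts simp del: simplex_part_simps perplex_part_simps)
qed

lemma psi_mult_vec:
  assumes M: "M \<in> carrier_mat nr nc" and v: "v \<in> carrier_vec nc"
  shows "psi M *\<^sub>v psi_vec v = psi_vec (M *\<^sub>v v)"
  unfolding psi_def Let_def psi_vec_def
  by (subst four_block_mat_mult_vec[of _ nr nc _ nc _ nr], use M v in auto)
    (rule arg_cong2[where f = append_vec]; rule eq_vecI;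
      use M v in \<open>auto simp: scalar_prod_def simplex_part_sum simplex_part_mult perplex_part_sum
        perplex_part_mult sum_subtractf sum_negf sum.distrib\<close>)+

text \<open>Stacking the parts of \<open>a + j b\<close> as \<open>a\<close> over \<open>b\<close>
  is chosen for this property: right multiplication by a complex number becomes ordinary
  scaling.\<close>

lemma psi_vec_scale:
  "psi_vec (map_vec (\<lambda>x. x * quat_of_complex z) v) = z \<cdot>\<^sub>v psi_vec v"
  by (intro eq_vecI) (auto simp: psi_vec_def simplex_part_mult perplex_part_mult)

text \<open>The bijection \<open>psi_vec\<close> carries \<open>M\<close> to \<open>psi M\<close>
  and right multiplication by \<open>z\<close> to scaling by \<open>z\<close>, so it matches the
  eigenvectors on both sides.\<close>

lemma right_eigenvalue_complex_iff:
  assumes M: "M \<in> carrier_mat n n"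
  shows "right_eigenvalue M (quat_of_complex z) \<longleftrightarrow> z \<in># Spec (psi M)"
proof -
  have dim: "dim_row M = n" "dim_row (psi M) = n + n"
    using M carrier_matD(1)[OF psi_carrier[OF M]] by auto
  have ev: "(M *\<^sub>v v = map_vec (\<lambda>x. x * quat_of_complex z) v) \<longleftrightarrow> psi M *\<^sub>v psi_vec v = z \<cdot>\<^sub>v psi_vec v"
    if v: "v \<in> carrier_vec n" for v
  proof -
    have "M *\<^sub>v v \<in> carrier_vec n" "map_vec (\<lambda>x. x * quat_of_complex z) v \<in> carrier_vec n"
      using M v by auto
    from psi_vec_inj[OF this] show ?thesis
      unfolding psi_mult_vec[OF M v] psi_vec_scale[symmetric] by metis
  qed
  have nz: "psi_vec v = 0\<^sub>v (n + n) \<longleftrightarrow> v = 0\<^sub>v n" if v: "v \<in> carrier_vec n" for v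
    using psi_vec_inj[OF v zero_carrier_vec] psi_vec_zero[of n] by auto
  have "right_eigenvalue M (quat_of_complex z) \<longleftrightarrow> eigenvalue (psi M) z"
  proof
    assume "right_eigenvalue M (quat_of_complex z)"
    then obtain v where "v \<in> carrier_vec n" "v \<noteq> 0\<^sub>v n"
      "M *\<^sub>v v = map_vec (\<lambda>x. x * quat_of_complex z) v"
      by (auto simp: right_eigenvalue_def dim)
    then show "eigenvalue (psi M) z"
      unfolding eigenvalue_def eigenvector_def dim
      by (intro exI[of _ "psi_vec v"]) (simp add: ev nz)
  next
    assume "eigenvalue (psi M) z"
    then obtain w where w: "w \<in> carrier_vec (n + n)" "w \<noteq> 0\<^sub>v (n + n)" "psi M *\<^sub>v w = z \<cdot>\<^sub>v w"
      by (auto simp: eigenvalue_def eigenvector_def dim)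
    from psi_vec_surj[OF w(1)] obtain v where "v \<in> carrier_vec n" "psi_vec v = w" .
    then show "right_eigenvalue M (quat_of_complex z)"
      using w unfolding right_eigenvalue_def dim by (intro bexI[of _ v]) (auto simp: ev nz)
  qed
  also have "\<dots> \<longleftrightarrow> z \<in># Spec (psi M)"
    using mem_Spec_iff[OF psi_carrier[OF M]] by simp
  finally show ?thesis .
qed

text \<open>From \<open>M v = v l\<close> follows
  \<open>M (v x) = (v x) (x\<^sup>-\<^sup>1 l x)\<close>, as matrices act from the left and scalars
  from the right.\<close>

lemma right_eigenvalue_conj:
  assumes l: "right_eigenvalue M l" and x: "x \<noteq> 0"
  shows "right_eigenvalue M (inverse x * l * x)"
proof -
  obtain v where v: "v \<in> carrier_vec (dim_row M)" "v \<noteq> 0\<^sub>v (dim_row M)"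
    "M *\<^sub>v v = map_vec (\<lambda>y. y * l) v"
    using l by (auto simp: right_eigenvalue_def)
  have *: "x * (inverse x * y) = y" for y
    using x by (simp flip: mult.assoc)
  let ?w = "map_vec (\<lambda>y. y * x) v"
  have "M *\<^sub>v ?w = map_vec (\<lambda>y. y * x) (M *\<^sub>v v)"
    using v(1) by (intro eq_vecI) (auto simp: scalar_prod_def sum_distrib_right mult.assoc)
  also have "\<dots> = map_vec (\<lambda>y. y * (inverse x * l * x)) ?w"
    unfolding v(3) using * by (intro eq_vecI) (auto simp: mult.assoc)
  finally have "M *\<^sub>v ?w = map_vec (\<lambda>y. y * (inverse x * l * x)) ?w" .
  moreover have "?w \<noteq> 0\<^sub>v (dim_row M)"
    using v(1,2) x by (auto simp: vec_eq_iff)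
  ultimately show ?thesis
    using v(1) unfolding right_eigenvalue_def by (intro bexI[of _ ?w]) auto
qed

text \<open>
  If \<open>x = a + w\<close> with \<open>a\<close> real and \<open>w\<close> purely imaginary of norm \<open>t\<close>, then \<open>y = w + t i\<close>
  satisfies \<open>y w = t i y\<close>, because both \<open>w\<close> and \<open>t i\<close> have square \<open>- t\<^sup>2\<close>.
\<close>

lemma quat_conj_complex:
  obtains z y where "y \<noteq> 0" "y * x = quat_of_complex z * y"
proof -
  define t where "t = sqrt ((Im1 x)\<^sup>2 + (Im2 x)\<^sup>2 + (Im3 x)\<^sup>2)"
  have t: "t * t = Im1 x * Im1 x + Im2 x * Im2 x + Im3 x * Im3 x"
    by (simp add: t_def power2_eq_square)
  let ?y = "Quat 0 (Im1 x + t) (Im2 x) (Im3 x)"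
  let ?z = "Complex (Re0 x) t"
  show thesis
  \<comment> \<open>The general choice fails exactly when \<open>x = a - t i\<close>. Conjugation by
    \<open>j\<close> then reverses the sign of the imaginary part; real \<open>x\<close> falls under
    this case with \<open>t = 0\<close>.\<close>
  proof (cases "?y = 0")
    case True
    then have "Im1 x = - t" "Im2 x = 0" "Im3 x = 0"
      by (auto simp: quat_eq_iff)
    then have "quat_j * x = quat_of_complex ?z * quat_j"
      by (simp add: quat_eq_iff quat_times_sel quat_j_def quat_of_complex_def)
    moreover have "quat_j \<noteq> 0"
      by (simp add: quat_eq_iff quat_j_def)
    ultimately show ?thesis
      using that by blast
  next
    case False
    have "?y * x = quat_of_complex ?z * ?y"
      using t by (simp add: quat_eq_iff quat_times_sel quat_of_complex_def algebra_simps)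
    then show ?thesis
      using that False by blast
  qed
qed

text \<open>The right spectrum is a union of similarity classes, and each class contains a complex
  number, so the complex right eigenvalues determine it.\<close>

lemma right_spectrum_eq:
  assumes M: "M \<in> carrier_mat n n"
  shows "right_spectrum M = (\<Union>z\<in>set_mset (Spec (psi M)). quat_class (quat_of_complex z))"
proof (intro equalityI subsetI)
  fix x assume "x \<in> right_spectrum M"
  then have x: "right_eigenvalue M x"
    by (simp add: right_spectrum_def)
  obtain z y where y: "y \<noteq> 0" "y * x = quat_of_complex z * y"
    by (rule quat_conj_complex)
  have "quat_of_complex z = (y * x) * inverse y"
    unfolding y(2) using y(1) by (simp add: mult.assoc)
  then have "z \<in># Spec (psi M)"
    using right_eigenvalue_conj[OF x, of "inverse y"] y by (simp add: right_eigenvalue_complex_iff[OF M])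
  moreover have "x = inverse y * quat_of_complex z * y"
    using y by (metis mult.assoc left_inverse mult_1)
  then have "x \<in> quat_class (quat_of_complex z)"
    using y by (auto simp: quat_class_def)
  ultimately show "x \<in> (\<Union>z\<in>set_mset (Spec (psi M)). quat_class (quat_of_complex z))"
    by blast
next
  fix x assume "x \<in> (\<Union>z\<in>set_mset (Spec (psi M)). quat_class (quat_of_complex z))"
  then show "x \<in> right_spectrum M"
    using right_eigenvalue_conj right_eigenvalue_complex_iff[OF M]
    by (auto simp: quat_class_def right_spectrum_def)
qed

text \<open>Conjugation by \<open>j\<close> realises complex conjugation. Hence one member of each
  conjugate pair is enough to describe the right spectrum.\<close>

lemma quat_class_cnj: "quat_class (quat_of_complex (cnj z)) = quat_class (quat_of_complex z)"
proof -
  have *: "quat_of_complex (cnj z) = inverse quat_j * quat_of_complex z * quat_j" for z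
    by (simp add: quat_eq_iff quat_times_sel quat_j_def quat_of_complex_def inverse_quat_def
        inner_quat_def quat_cnj_def)
  have j: "quat_j \<noteq> 0"
    by (simp add: quat_eq_iff quat_j_def)
  have "quat_class (quat_of_complex (cnj z)) \<subseteq> quat_class (quat_of_complex z)" for z
  proof
    fix l assume "l \<in> quat_class (quat_of_complex (cnj z))"
    then obtain x where x: "x \<noteq> 0" "l = inverse x * quat_of_complex (cnj z) * x"
      by (auto simp: quat_class_def)
    then have "l = inverse (quat_j * x) * quat_of_complex z * (quat_j * x)"
      using j by (simp add: * nonzero_inverse_mult_distrib mult.assoc)
    then show "l \<in> quat_class (quat_of_complex z)"
      using x j unfolding quat_class_def by (auto intro!: exI[of _ "quat_j * x"])
  qed
  from this[of z] this[of "cnj z"] show ?thesis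
    by auto
qed

section \<open>Matrices with rows and columns indexed by different lists\<close>

definition rect_mat :: "'i list \<Rightarrow> 'j list \<Rightarrow> ('i \<Rightarrow> 'j \<Rightarrow> 'a) \<Rightarrow> 'a mat" where
  "rect_mat xs ys f = mat (length xs) (length ys) (\<lambda>(i, j). f (xs ! i) (ys ! j))"

lemma rect_mat_carrier [simp]: "rect_mat xs ys f \<in> carrier_mat (length xs) (length ys)"
  by (simp add: rect_mat_def)

lemma mat_on_eq_rect_mat: "mat_on xs f = rect_mat xs xs f"
  by (simp add: mat_on_def rect_mat_def)

lemma rect_mat_cong:
  "(\<And>x y. x \<in> set xs \<Longrightarrow> y \<in> set ys \<Longrightarrow> f x y = g x y) \<Longrightarrow> rect_mat xs ys f = rect_mat xs ys g"
  by (auto simp: rect_mat_def intro!: eq_matI)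

lemma rect_mat_mult:
  assumes "distinct ys"
  shows "rect_mat xs ys f * rect_mat ys zs g = rect_mat xs zs (\<lambda>x z. \<Sum>y\<in>set ys. f x y * g y z)"
proof (rule eq_matI)
  fix i j
  assume "i < dim_row (rect_mat xs zs (\<lambda>x z. \<Sum>y\<in>set ys. f x y * g y z))"
    and "j < dim_col (rect_mat xs zs (\<lambda>x z. \<Sum>y\<in>set ys. f x y * g y z))"
  moreover have "(\<Sum>y\<in>set ys. f x y * g y z) = (\<Sum>k = 0..<length ys. f x (ys ! k) * g (ys ! k) z)" for x z
    using bij_betw_nth[OF assms refl refl]
    by (subst sum.reindex_bij_betw[symmetric, of "(!) ys" "{..<length ys}"]) (auto simp: lessThan_atLeast0)
  ultimately show "(rect_mat xs ys f * rect_mat ys zs g) $$ (i, j)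
      = rect_mat xs zs (\<lambda>x z. \<Sum>y\<in>set ys. f x y * g y z) $$ (i, j)"
    by (simp add: rect_mat_def scalar_prod_def)
qed (auto simp: rect_mat_def)

lemma rect_mat_minus: "rect_mat xs ys f - rect_mat xs ys g = rect_mat xs ys (\<lambda>x y. f x y - g x y)"
  by (auto simp: rect_mat_def intro!: eq_matI)

lemma rect_mat_diagonal:
  assumes "distinct xs"
  shows "rect_mat xs xs (\<lambda>x y. if x = y then c else 0) = (c :: 'a :: semiring_1) \<cdot>\<^sub>m 1\<^sub>m (length xs)"
  using assms by (auto simp: rect_mat_def nth_eq_iff_index_eq intro!: eq_matI)

section \<open>Edge counts and trees\<close>

text \<open>The arc set is its own symmetric closure, and a walk that starts at a vertex stays among
  the vertices.\<close>

lemma (in pair_sym_digraph) connected_iff_rtrancl: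
  "connected (with_proj G) \<longleftrightarrow> pverts G \<noteq> {} \<and> (\<forall>u\<in>pverts G. \<forall>v\<in>pverts G. (u, v) \<in> (parcs G)\<^sup>*)"
proof -
  have "symcl (parcs G) = parcs G"
    using pair_sym_arcs by (auto simp: symcl_def symmetric_def dest: symD)
  moreover have "(u, v) \<in> rtrancl_on (pverts G) (parcs G) \<longleftrightarrow> (u, v) \<in> (parcs G)\<^sup>*"
    if "u \<in> pverts G" for u v
  proof
    assume "(u, v) \<in> (parcs G)\<^sup>*"
    then show "(u, v) \<in> rtrancl_on (pverts G) (parcs G)"
      by induction (auto intro: that rtrancl_on_into_rtrancl_on in_arcsD2)
  qed (rule rtrancl_on_rtranclI)
  ultimately show ?thesis
    by (auto simp: connected_conv)
qed

lemma (in pair_pseudo_graph) pair_graph_remove_loops: "pair_graph (remove_loops G)"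
proof
  show "symmetric (with_proj (remove_loops G))"
    using pair_sym_arcs by (auto simp: symmetric_def sym_def remove_loops_def)
  show "finite (parcs (remove_loops G))"
    by (rule finite_subset[OF _ pair_finite_arcs]) (auto simp: remove_loops_def)
qed (use pair_finite_verts in \<open>auto simp: remove_loops_def dest: in_arcsD1 in_arcsD2\<close>)

lemma (in pair_pseudo_graph) connected_remove_loops:
  assumes "connected (with_proj G)"
  shows "connected (with_proj (remove_loops G))"
proof -
  interpret H: pair_graph "remove_loops G"
    by (rule pair_graph_remove_loops)
  have "parcs (remove_loops G) = parcs G - Id" "pverts (remove_loops G) = pverts G"
    by (auto simp: remove_loops_def)
  then show ?thesis
    using assms by (simp add: H.connected_iff_rtrancl connected_iff_rtrancl rtrancl_r_diff_Id)
qed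

text \<open>The function \<open>d\<close> is the distance from the root \<open>r\<close>, and \<open>p\<close> the parent in a breadth-first tree.\<close>

lemma (in pair_graph) obtain_parents:
  assumes "connected (with_proj G)"
  obtains r p and d :: "'a \<Rightarrow> nat"
  where "r \<in> pverts G"
    and "\<And>v. v \<in> pverts G \<Longrightarrow> v \<noteq> r \<Longrightarrow> (p v, v) \<in> parcs G"
    and "\<And>v. v \<in> pverts G \<Longrightarrow> v \<noteq> r \<Longrightarrow> d v = Suc (d (p v))"
    and "card ((\<lambda>v. {v, p v}) ` (pverts G - {r})) + 1 = card (pverts G)"
proof -
  obtain r where r: "r \<in> pverts G"
    using assms by (auto simp: connected_iff_rtrancl)
  define d where "d v = (LEAST k. (r, v) \<in> parcs G ^^ k)" for v
  \<comment> \<open>The parent is the last but one vertex on a shortest walk from \<open>r\<close>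
    to \<open>v\<close>.\<close>
  have "\<exists>w. (w, v) \<in> parcs G \<and> d v = Suc (d w)" if v: "v \<in> pverts G" "v \<noteq> r" for v
  proof -
    have "(r, v) \<in> (parcs G)\<^sup>*"
      using assms r v by (auto simp: connected_iff_rtrancl)
    then have dv: "(r, v) \<in> parcs G ^^ d v"
      unfolding d_def by (metis LeastI rtrancl_imp_relpow)
    with v obtain k where k: "d v = Suc k"
      by (cases "d v") auto
    with dv obtain w where w: "(r, w) \<in> parcs G ^^ k" "(w, v) \<in> parcs G"
      by auto
    have "d w \<le> k"
      unfolding d_def using w(1) by (rule Least_le)
    moreover have "(r, v) \<in> parcs G ^^ Suc (d w)"
      using w unfolding d_def by (auto intro: LeastI)
    then have "d v \<le> Suc (d w)"
      unfolding d_def by (rule Least_le)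
    ultimately show ?thesis
      using w k by auto
  qed
  then obtain p where p: "\<And>v. v \<in> pverts G \<Longrightarrow> v \<noteq> r \<Longrightarrow> (p v, v) \<in> parcs G \<and> d v = Suc (d (p v))"
    by metis
  \<comment> \<open>Two vertices with the same parent edge would be parents of each other, against
    the growth of \<open>d\<close>.\<close>
  have "inj_on (\<lambda>v. {v, p v}) (pverts G - {r})"
  proof (rule inj_onI)
    fix v w assume vw: "v \<in> pverts G - {r}" "w \<in> pverts G - {r}" "{v, p v} = {w, p w}"
    show "v = w"
    proof (rule ccontr)
      assume "v \<noteq> w"
      with vw(3) have "v = p w" "w = p v"
        by (auto simp: doubleton_eq_iff)
      then show False
        using p[of v] p[of w] vw by auto
    qed
  qed
  then have "card ((\<lambda>v. {v, p v}) ` (pverts G - {r})) = card (pverts G - {r})"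
    by (rule card_image)
  then have "card ((\<lambda>v. {v, p v}) ` (pverts G - {r})) + 1 = card (pverts G)"
    using r pair_finite_verts card_Suc_Diff1[of "pverts G" r] by simp
  with that[of r p d] r p show thesis
    by blast
qed

lemma (in pair_sym_digraph) arc_sym: "(u, v) \<in> parcs G \<Longrightarrow> (v, u) \<in> parcs G"
  using pair_sym_arcs by (auto simp: symmetric_def dest: symD)

lemma (in pair_fin_digraph) finite_edge_set: "finite (edge_set G)"
proof -
  have "edge_set G = (\<lambda>(u, v). {u, v}) ` parcs G"
    by (auto simp: edge_set_def)
  then show ?thesis
    using pair_finite_arcs by simp
qed

section \<open>Cycles and the number of edges\<close>

lemma pawalk_verts_eq_snd: "pcas u p v \<Longrightarrow> pawalk_verts u p = u # map snd p"
  by (induction p arbitrary: u) auto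

lemma pcas_nth: "pcas u p v \<Longrightarrow> Suc i < length p \<Longrightarrow> snd (p ! i) = fst (p ! Suc i)"
proof (induction p arbitrary: u i)
  case (Cons e p)
  then show ?case
    by (cases i; cases p) auto
qed simp

lemma pcas_ends: "pcas u p v \<Longrightarrow> p \<noteq> [] \<Longrightarrow> fst (p ! 0) = u \<and> snd (p ! (length p - 1)) = v"
proof (induction p arbitrary: u)
  case (Cons e p)
  then show ?case
    by (cases p) auto
qed simp

text \<open>With fewer edges than vertices, every edge is a parent edge. At a vertex of the cycle
  farthest from the root both neighbours on the cycle must then be its parent, so the cycle would
  visit one vertex twice.\<close>

lemma (in pair_graph) cycle_imp_card_edge_set:
  assumes conn: "connected (with_proj G)" and c: "cycle c" "3 \<le> length c"
  shows "card (pverts G) \<le> card (edge_set G)"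
proof (rule ccontr)
  assume less: "\<not> card (pverts G) \<le> card (edge_set G)"
  obtain r p and d :: "'a \<Rightarrow> nat" where r: "r \<in> pverts G"
    and par: "\<And>v. v \<in> pverts G \<Longrightarrow> v \<noteq> r \<Longrightarrow> (p v, v) \<in> parcs G"
    and d: "\<And>v. v \<in> pverts G \<Longrightarrow> v \<noteq> r \<Longrightarrow> d v = Suc (d (p v))"
    and card: "card ((\<lambda>v. {v, p v}) ` (pverts G - {r})) + 1 = card (pverts G)"
    using obtain_parents[OF conn] by blast
  have "(\<lambda>v. {v, p v}) ` (pverts G - {r}) \<subseteq> edge_set G"
    using par arc_sym by (fastforce simp: edge_set_def)
  then have tree: "edge_set G = (\<lambda>v. {v, p v}) ` (pverts G - {r})"
    using less card by (intro card_seteq[symmetric] finite_edge_set) auto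
  obtain u where u: "set c \<subseteq> parcs G" "pcas u c u" "distinct (tl (pawalk_verts u c))"
    using c(1) by (auto simp: cycle_def awalk_def)
  then have dist: "distinct (map snd c)"
    by (simp add: pawalk_verts_eq_snd)
  define L where "L = length c"
  have L: "3 \<le> L" and c0: "c \<noteq> []"
    using c(2) by (auto simp: L_def)
  have "finite ((\<lambda>e. d (snd e)) ` set c)" "(\<lambda>e. d (snd e)) ` set c \<noteq> {}"
    using c0 by auto
  from Max_in[OF this] Max_ge[OF this(1)]
  obtain e where e: "e \<in> set c" "\<And>e'. e' \<in> set c \<Longrightarrow> d (snd e') \<le> d (snd e)"
    by fastforce
  then obtain i where i: "i < L" "e = c ! i"
    by (auto simp: in_set_conv_nth L_def)
  \<comment> \<open>The arcs at \<open>j\<close> and \<open>k\<close> are the cyclic successor and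
    predecessor of \<open>e\<close>. They differ because the length is at least 3.\<close>
  define j where "j = (if Suc i < L then Suc i else 0)"
  define k where "k = (if i = 0 then L - 1 else i - 1)"
  have jk: "j < L" "k < L" "j \<noteq> k"
    using i L by (auto simp: j_def k_def)
  have j: "fst (c ! j) = snd e"
    using pcas_nth[OF u(2), of i] pcas_ends[OF u(2) c0] i
    by (auto simp: j_def L_def not_less_eq less_Suc_eq)
  have k: "snd (c ! k) = fst e"
    using pcas_nth[OF u(2), of "i - 1"] pcas_ends[OF u(2) c0] i
    by (auto simp: k_def L_def)
  \<comment> \<open>An edge joins a vertex to its parent; a child of \<open>snd e\<close> would lie
    farther from the root.\<close>
  have parent: "y = p (snd e)" if y: "{snd e, y} \<in> edge_set G" "d y \<le> d (snd e)" for y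
  proof -
    obtain w where w: "w \<in> pverts G - {r}" "{snd e, y} = {w, p w}"
      using y(1) by (auto simp: tree)
    then consider "snd e = w" "y = p w" | "snd e = p w" "y = w"
      by (auto simp: doubleton_eq_iff)
    then show ?thesis
      using d[of w] w(1) y(2) by cases auto
  qed
  have mem: "c ! j \<in> set c" "c ! k \<in> set c"
    using jk by (auto simp: L_def)
  have "(snd e, snd (c ! j)) \<in> parcs G" "(fst e, snd e) \<in> parcs G"
    using u(1) mem e(1) j by (metis prod.collapse subsetD)+
  then have "{snd e, snd (c ! j)} \<in> edge_set G" "{fst e, snd e} \<in> edge_set G"
    unfolding edge_set_def by blast+
  then have "{snd e, snd (c ! j)} \<in> edge_set G" "{snd e, snd (c ! k)} \<in> edge_set G"
    by (simp_all add: k insert_commute)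
  then have "snd (c ! j) = snd (c ! k)"
    using parent e(2) mem by metis
  then show False
    using dist jk by (auto simp: distinct_conv_nth L_def)
qed

text \<open>The parent edges are one fewer than the vertices, so some edge is not among them.
  Deleting it keeps the graph connected, and a path between its ends closes up to a cycle.\<close>

lemma (in pair_graph) card_edge_set_imp_cycle:
  assumes conn: "connected (with_proj G)" and card_ge: "card (pverts G) \<le> card (edge_set G)"
  obtains c where "cycle c" "3 \<le> length c"
proof -
  obtain r p and d :: "'a \<Rightarrow> nat" where r: "r \<in> pverts G"
    and par: "\<And>v. v \<in> pverts G \<Longrightarrow> v \<noteq> r \<Longrightarrow> (p v, v) \<in> parcs G"
    and d: "\<And>v. v \<in> pverts G \<Longrightarrow> v \<noteq> r \<Longrightarrow> d v = Suc (d (p v))"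
    and card: "card ((\<lambda>v. {v, p v}) ` (pverts G - {r})) + 1 = card (pverts G)"
    using obtain_parents[OF conn] by blast
  have "\<not> edge_set G \<subseteq> (\<lambda>v. {v, p v}) ` (pverts G - {r})"
    using card_mono[of "(\<lambda>v. {v, p v}) ` (pverts G - {r})" "edge_set G"] pair_finite_verts card card_ge
    by auto
  then obtain a b where ab: "(a, b) \<in> parcs G"
    and new: "{a, b} \<notin> (\<lambda>v. {v, p v}) ` (pverts G - {r})"
    by (auto simp: edge_set_def)
  define H where "H = G\<lparr>parcs := parcs G - {(a, b), (b, a)}\<rparr>"
  have H: "pverts H = pverts G" "parcs H = parcs G - {(a, b), (b, a)}"
    by (simp_all add: H_def)
  interpret H: pair_graph H
  proof
    show "symmetric (with_proj H)"
      using arc_sym by (auto simp: symmetric_def sym_def H)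
  qed (use pair_finite_verts pair_finite_arcs pair_no_loops in \<open>auto simp: H dest: in_arcsD1 in_arcsD2\<close>)
  \<comment> \<open>All parent arcs survive in \<open>H\<close>, so induction on the distance
    \<open>d\<close> reaches every vertex.\<close>
  have root: "r \<rightarrow>\<^sup>*\<^bsub>with_proj H\<^esub> v" if "v \<in> pverts G" for v
    using that
  proof (induction "d v" arbitrary: v rule: less_induct)
    case less
    show ?case
    proof (cases "v = r")
      case False
      have "(p v, v) \<in> parcs H"
        using par[OF less.prems False] new less.prems False by (auto simp: H insert_commute)
      then show ?thesis
        using less.hyps[of "p v"] d[OF less.prems False] H.in_arcsD1[of "p v" v] H
        by (auto intro: H.reachable_adj_trans)
    qed (use r H in auto)
  qed
  have "a \<in> pverts G" "b \<in> pverts G"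
    using ab in_arcsD1 in_arcsD2 by auto
  then have "b \<rightarrow>\<^sup>*\<^bsub>with_proj H\<^esub> a"
    using root H.pair_sym_arcs symmetric_reachable H.reachable_trans by metis
  then obtain q where q: "H.apath b q a"
    using H.reachable_apath by auto
  have "a \<noteq> b"
    using pair_no_loops[OF ab] by simp
  \<comment> \<open>The path is not empty since \<open>a\<close> and \<open>b\<close> differ, and it
    is not a single arc since \<open>(b, a)\<close> was deleted.\<close>
  then have "2 \<le> length q"
    using q by (cases q rule: remdups_adj.cases) (auto simp: H.apath_def H.awalk_def H)
  moreover have "cycle ((a, b) # q)"
    using q ab \<open>a \<in> pverts G\<close>
    by (auto simp: cycle_def awalk_def H.apath_def H.awalk_def H intro!: exI[of _ a])
  ultimately show thesis
    using that[of "(a, b) # q"] by simp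
qed

text \<open>The parent edges show that there are at most one fewer edges than vertices; the two
  preceding lemmas then decide which case occurs.\<close>

lemma (in pair_graph) undirected_tree_iff:
  assumes "connected (with_proj G)"
  shows "undirected_tree G \<longleftrightarrow> card (edge_set G) + 1 = card (pverts G)"
    and "\<not> undirected_tree G \<longleftrightarrow> card (pverts G) \<le> card (edge_set G)"
proof -
  obtain r p where r: "r \<in> pverts G"
    and par: "\<And>v. v \<in> pverts G \<Longrightarrow> v \<noteq> r \<Longrightarrow> (p v, v) \<in> parcs G"
    and card: "card ((\<lambda>v. {v, p v}) ` (pverts G - {r})) + 1 = card (pverts G)"
    using obtain_parents[OF assms] by metis
  have "(\<lambda>v. {v, p v}) ` (pverts G - {r}) \<subseteq> edge_set G"
    using par arc_sym by (fastforce simp: edge_set_def)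
  then have "card (pverts G) \<le> card (edge_set G) + 1"
    using card by (metis add_le_mono1 card_mono finite_edge_set)
  moreover show *: "\<not> undirected_tree G \<longleftrightarrow> card (pverts G) \<le> card (edge_set G)"
    using cycle_imp_card_edge_set[OF assms] card_edge_set_imp_cycle[OF assms] assms
    unfolding undirected_tree_def by metis
  ultimately show "undirected_tree G \<longleftrightarrow> card (edge_set G) + 1 = card (pverts G)"
    by linarith
qed

text \<open>An injective numbering of the vertices selects one arc of each edge that is not a loop.
  The arcs split into \<open>F\<close>, its reversal and the loops, which gives the counts;
  \<open>F\<close> also indexes the columns of the incidence matrix used for the walk.\<close>

lemma (in pair_pseudo_graph) obtain_orientation:
  obtains F where "F \<subseteq> parcs G" and "\<And>u v. (u, v) \<in> F \<Longrightarrow> (v, u) \<notin> F"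
    and "\<And>u v. (u, v) \<in> parcs G \<Longrightarrow> u \<noteq> v \<Longrightarrow> (u, v) \<in> F \<or> (v, u) \<in> F"
    and "card F = card (edge_set (remove_loops G))"
    and "card (parcs G) = 2 * card F + card (loop_set G)"
    and "card (edge_set G) = card F + card (loop_set G)"
proof -
  obtain f :: "'a \<Rightarrow> nat" where f: "inj_on f (pverts G)"
    using pair_finite_verts finite_imp_inj_to_nat_seg by blast
  define F where "F = {(u, v) \<in> parcs G. f u < f v}"
  have F: "F \<subseteq> parcs G" "finite F"
    by (auto simp: F_def intro: finite_subset[OF _ pair_finite_arcs])
  have anti: "(v, u) \<notin> F" if "(u, v) \<in> F" for u v
    using that by (auto simp: F_def)
  have total: "(u, v) \<in> F \<or> (v, u) \<in> F" if "(u, v) \<in> parcs G" "u \<noteq> v" for u v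
    using that f arc_sym[of u v] in_arcsD1[of u v] in_arcsD2[of u v]
    by (auto simp: F_def inj_on_def) (metis linorder_neqE_nat)
  define L where "L = {e \<in> parcs G. fst e = snd e}"
  have L: "finite L"
    using pair_finite_arcs by (simp add: L_def)
  have "loop_set G = (\<lambda>(u, v). {u, v}) ` L"
    by (force simp: loop_set_def L_def)
  moreover have "inj_on (\<lambda>(u, v). {u, v}) L"
    by (auto simp: inj_on_def L_def)
  ultimately have cL: "card (loop_set G) = card L"
    by (simp add: card_image)
  have irr: "(u, u) \<notin> F" for u
    using anti by blast
  have "edge_set (remove_loops G) = (\<lambda>(u, v). {u, v}) ` F"
  proof (intro equalityI subsetI)
    fix x assume "x \<in> edge_set (remove_loops G)"
    then obtain u v where "x = {u, v}" "(u, v) \<in> parcs G" "u \<noteq> v"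
      by (auto simp: edge_set_def remove_loops_def)
    then show "x \<in> (\<lambda>(u, v). {u, v}) ` F"
      using total[of u v] by (force simp: insert_commute)
  next
    fix x assume "x \<in> (\<lambda>(u, v). {u, v}) ` F"
    then obtain u v where "x = {u, v}" "(u, v) \<in> F"
      by auto
    moreover from this have "u \<noteq> v"
      using irr by auto
    ultimately show "x \<in> edge_set (remove_loops G)"
      using F(1) by (auto simp: edge_set_def remove_loops_def)
  qed
  moreover have "inj_on (\<lambda>(u, v). {u, v}) F"
    using anti by (auto simp: inj_on_def doubleton_eq_iff)
  ultimately have cF: "card F = card (edge_set (remove_loops G))"
    by (simp add: card_image)
  have "(u, v) \<in> parcs G \<longleftrightarrow> (u, v) \<in> F \<union> prod.swap ` F \<union> L" for u v
    using total[of u v] arc_sym[of v u] F(1) by (auto simp: L_def pair_in_swap_image)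
  then have "parcs G = F \<union> prod.swap ` F \<union> L"
    by auto
  moreover have "F \<inter> prod.swap ` F = {}" "(F \<union> prod.swap ` F) \<inter> L = {}"
    using anti irr by (auto simp: L_def)
  moreover have "card (prod.swap ` F) = card F"
    by (rule card_image) (auto simp: inj_on_def)
  ultimately have "card (parcs G) = 2 * card F + card L"
    using F(2) L by (simp add: card_Un_disjoint)
  moreover have "edge_set G = edge_set (remove_loops G) \<union> loop_set G"
    "edge_set (remove_loops G) \<inter> loop_set G = {}"
    by (auto simp: edge_set_def remove_loops_def loop_set_def doubleton_eq_iff)
  moreover have "finite (edge_set G)"
    by (rule finite_edge_set)
  ultimately show thesis
    using that[OF F(1) anti total cF] by (simp add: cL cF card_Un_disjoint)
qed

section \<open>Multisets of conjugate pairs\<close>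

lemma count_image_mset_cnj [simp]: "count (image_mset cnj M) x = count M (cnj x)"
  by (induction M) auto

text \<open>A real number is its own partner, whence the parity condition. Conversely,
  \<open>N\<close> takes everything above the real axis, half of the multiplicity on it and nothing
  below.\<close>

lemma conj_pairs_iff:
  "(\<exists>N. M = N + image_mset cnj N)
    \<longleftrightarrow> (\<forall>x. count M (cnj x) = count M x) \<and> (\<forall>x\<in>\<real>. even (count M x))"
proof (intro iffI conjI; (elim conjE)?)
  assume "\<exists>N. M = N + image_mset cnj N"
  then show "\<forall>x. count M (cnj x) = count M x" "\<forall>x\<in>\<real>. even (count M x)"
    by (auto simp: Reals_cnj_iff)
next
  assume sym: "\<forall>x. count M (cnj x) = count M x" and ev: "\<forall>x\<in>\<real>. even (count M x)"
  define f where "f x = (if Im x > 0 then count M x else if Im x = 0 then count M x div 2 else 0)" for x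
  have "{x. 0 < f x} \<subseteq> set_mset M"
    by (auto simp: f_def split: if_splits simp flip: count_greater_zero_iff)
  then have "finite {x. 0 < f x}"
    by (rule finite_subset) simp
  then have count: "count (Abs_multiset f) = f"
    by (rule count_Abs_multiset)
  have "count M x = f x + f (cnj x)" for x
  proof (cases "Im x = 0")
    case True
    then have "x \<in> \<real>" "cnj x = x"
      by (auto simp: complex_is_Real_iff complex_eq_iff)
    moreover from this ev have "even (count M x)"
      by blast
    ultimately show ?thesis
      using True by (auto simp: f_def elim!: evenE)
  qed (use sym in \<open>auto simp: f_def\<close>)
  then have "M = Abs_multiset f + image_mset cnj (Abs_multiset f)"
    by (intro multiset_eqI) (simp add: count)
  then show "\<exists>N. M = N + image_mset cnj N" ..
qed

text \<open>Symmetry and parity of the multiplicities survive subtraction. This makes the criterion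
  applicable to a spectrum known only after padding with copies of 1 and -1.\<close>

lemma conj_pairs_cancel:
  assumes "M + (A + image_mset cnj A) = B + image_mset cnj B"
  shows "\<exists>N. M = N + image_mset cnj N"
proof -
  have "count M x + (count A x + count A (cnj x)) = count B x + count B (cnj x)" for x
    using arg_cong[OF assms, of "\<lambda>M. count M x"] by simp
  note count = this
  have "count M (cnj x) = count M x" for x
    using count[of x] count[of "cnj x"] by simp
  moreover have "even (count M x)" if "x \<in> \<real>" for x
  proof -
    have "count M x + 2 * count A x = 2 * count B x"
      using count[of x] that by (simp add: Reals_cnj_iff)
    then show ?thesis
      by presburger
  qed
  ultimately show ?thesis
    by (simp add: conj_pairs_iff)
qed

text \<open>On the interval the square root is real, so the two lifts are conjugate. For real \<mu>
  outside it they would be distinct real numbers.\<close>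

lemma spectral_lift_conj_pairs:
  assumes "\<And>\<mu>. \<mu> \<in># S \<Longrightarrow> \<mu> \<in> \<real> \<and> - 2 \<le> Re \<mu> \<and> Re \<mu> \<le> 2"
  shows "\<exists>N. spectral_lift S = N + image_mset cnj N"
  using assms
proof (induction S)
  case (add \<mu> S)
  then obtain N where N: "spectral_lift S = N + image_mset cnj N"
    by auto
  define r where "r = Re \<mu>"
  have \<mu>: "\<mu> = of_real r" "- 2 \<le> r" "r \<le> 2"
    using add.prems[of \<mu>] by (auto simp: r_def complex_is_Real_iff complex_eq_iff)
  have "(r / 2)\<^sup>2 \<le> 1"
    using \<mu> by (simp add: abs_square_le_1 abs_le_iff)
  then have "csqrt (of_real (1 - (r / 2)\<^sup>2)) = of_real (sqrt (1 - (r / 2)\<^sup>2))"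
    by (simp add: csqrt_of_real_nonneg)
  moreover have "1 - (\<mu> / 2)\<^sup>2 = of_real (1 - (r / 2)\<^sup>2)"
    by (simp add: \<mu>)
  ultimately have "csqrt (1 - (\<mu> / 2)\<^sup>2) = of_real (sqrt (1 - (r / 2)\<^sup>2))"
    by simp
  then have "spectral_lift (add_mset \<mu> S) = add_mset (\<mu> / 2 + \<i> * csqrt (1 - (\<mu> / 2)\<^sup>2)) N
      + image_mset cnj (add_mset (\<mu> / 2 + \<i> * csqrt (1 - (\<mu> / 2)\<^sup>2)) N)"
    using N by (simp add: spectral_lift_def \<mu>(1))
  then show ?case ..
qed (auto simp: spectral_lift_def)

lemma size_spectral_lift: "size (spectral_lift M) = 2 * size M"
  by (induction M) (auto simp: spectral_lift_def)

section \<open>The doubly weighted matrix\<close>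

lemma quat_cnj_simps [simp]:
  "quat_cnj 0 = 0" "quat_cnj (quat_cnj x) = x" "quat_cnj (of_real r) = of_real r"
  "quat_cnj (x + y) = quat_cnj x + quat_cnj y" "quat_cnj (x * y) = quat_cnj y * quat_cnj x"
  "norm (quat_cnj x) = norm x"
  by (simp_all add: quat_eq_iff quat_cnj_def quat_times_sel of_real_def norm_quat_def inner_quat_def)

lemma quat_cnj_sum: "quat_cnj (sum f A) = (\<Sum>x\<in>A. quat_cnj (f x))"
  by (induction A rule: infinite_finite_induct) auto

lemma quat_cnj_mult: "quat_cnj x * x = of_real ((norm x)\<^sup>2)"
  using quat_mult_cnj[of "quat_cnj x"] by simp

lemma of_real_quat_commute: "of_real r * (x :: quat) = x * of_real r"
  by (simp add: of_real_def)

text \<open>Passing from list positions to a function on the index set lets the eigenvalue equation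
  be summed over vertices.\<close>

lemma right_eigenvalue_mat_onE:
  assumes l: "right_eigenvalue (mat_on xs f) l" and xs: "distinct xs"
  obtains x where "\<exists>u\<in>set xs. x u \<noteq> 0"
    and "\<And>u. u \<in> set xs \<Longrightarrow> (\<Sum>w\<in>set xs. f u w * x w) = x u * l"
proof -
  let ?n = "length xs"
  obtain v where v: "v \<in> carrier_vec ?n" "v \<noteq> 0\<^sub>v ?n" "mat_on xs f *\<^sub>v v = map_vec (\<lambda>x. x * l) v"
    using l by (auto simp: right_eigenvalue_def mat_on_def)
  have bij: "bij_betw ((!) xs) {..<?n} (set xs)"
    using xs by (simp add: bij_betw_nth)
  define x where "x u = v $ the_inv_into {..<?n} ((!) xs) u" for u
  have x: "x (xs ! i) = v $ i" if "i < ?n" for i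
    using that bij by (simp add: x_def the_inv_into_f_f bij_betw_imp_inj_on)
  obtain i where "i < ?n" "v $ i \<noteq> 0"
    using v(1,2) by (auto simp: vec_eq_iff)
  then have "\<exists>u\<in>set xs. x u \<noteq> 0"
    by (auto simp: x intro!: bexI[of _ "xs ! i"])
  moreover have "(\<Sum>w\<in>set xs. f u w * x w) = x u * l" if u: "u \<in> set xs" for u
  proof -
    obtain j where j: "j < ?n" "u = xs ! j"
      using u by (auto simp: in_set_conv_nth)
    have "(\<Sum>w\<in>set xs. f u w * x w) = (\<Sum>i<?n. f u (xs ! i) * v $ i)"
      by (subst sum.reindex_bij_betw[OF bij, symmetric]) (simp add: x)
    also have "\<dots> = (mat_on xs f *\<^sub>v v) $ j"
      using v(1) j by (simp add: mat_on_def scalar_prod_def lessThan_atLeast0)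
    also have "\<dots> = x u * l"
      using v(1) j unfolding v(3) by (simp add: x)
    finally show ?thesis .
  qed
  ultimately show thesis
    using that by blast
qed

locale szegedy_walk = pair_pseudo_graph G for G :: "'v pair_pre_digraph" +
  fixes q :: "'v \<times> 'v \<Rightarrow> quat"
  assumes q_norm: "\<And>u. u \<in> pverts G \<Longrightarrow> (\<Sum>e | e \<in> parcs G \<and> fst e = u. (norm (q e))\<^sup>2) = 1"
begin

lemma swap_mem_parcs: "prod.swap e \<in> parcs G \<longleftrightarrow> e \<in> parcs G"
  using pair_sym_arcs by (cases e) (auto simp: symmetric_def dest: symD)

lemma bij_swap: "bij_betw prod.swap (parcs G) (parcs G)"
  by (rule bij_betw_byWitness[of _ prod.swap]) (auto simp: swap_mem_parcs simp del: swap_simp)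

text \<open>
  For an eigenvector \<open>x\<close> put \<open>y e = q e x\<^sub>o\<^sub>(\<^sub>e\<^sub>)\<close>. Then \<open>x\<^sup>* W x\<close> is twice the sum of
  \<open>(y e)\<^sup>* y e\<^sup>-\<^sup>1\<close>, which is real by symmetry and at most \<open>\<Sum>\<bar>y e\<bar>\<^sup>2 = \<bar>x\<bar>\<^sup>2\<close>.
\<close>

lemma doubly_weighted_right_eigenvalue:
  assumes ev: "right_eigenvalue (mat_on vs (doubly_weighted_entry G q)) l"
    and vs: "distinct vs" "set vs = pverts G"
  shows "norm l \<le> 2" and "quat_cnj l = l"
proof -
  obtain x where nz: "\<exists>u\<in>pverts G. x u \<noteq> 0"
    and x: "\<And>u. u \<in> pverts G \<Longrightarrow> (\<Sum>w\<in>pverts G. doubly_weighted_entry G q u w * x w) = x u * l"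
    using right_eigenvalue_mat_onE[OF ev vs(1)] unfolding vs(2) by blast
  define y where "y e = q e * x (fst e)" for e
  define N where "N = (\<Sum>u\<in>pverts G. (norm (x u))\<^sup>2)"
  define T where "T = (\<Sum>e\<in>parcs G. quat_cnj (y e) * y (prod.swap e))"
  have sub: "parcs G \<subseteq> pverts G \<times> pverts G"
    using in_arcsD1 in_arcsD2 by auto
  \<comment> \<open>The Rayleigh quotient of \<open>x\<close>, rewritten as a sum over arcs; pairs
    of vertices that are not arcs contribute zero.\<close>
  have "of_real N * l = (\<Sum>u\<in>pverts G. quat_cnj (x u) * (x u * l))"
    by (simp add: N_def sum_distrib_right quat_cnj_mult flip: mult.assoc)
  also have "\<dots> = (\<Sum>u\<in>pverts G. \<Sum>w\<in>pverts G. quat_cnj (x u) * (doubly_weighted_entry G q u w * x w))"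
    by (intro sum.cong refl) (simp add: sum_distrib_left flip: x)
  also have "\<dots> = (\<Sum>e\<in>pverts G \<times> pverts G.
      quat_cnj (x (fst e)) * (doubly_weighted_entry G q (fst e) (snd e) * x (snd e)))"
    by (simp add: sum.cartesian_product case_prod_beta)
  also have "\<dots> = (\<Sum>e\<in>parcs G.
      quat_cnj (x (fst e)) * (doubly_weighted_entry G q (fst e) (snd e) * x (snd e)))"
    using sub arc_sym
    by (intro sum.mono_neutral_right) (auto simp: pair_finite_verts doubly_weighted_entry_def)
  also have "\<dots> = (\<Sum>e\<in>parcs G. 2 * (quat_cnj (y e) * y (prod.swap e)))"
  proof (rule sum.cong[OF refl])
    fix e assume "e \<in> parcs G"
    then have "doubly_weighted_entry G q (fst e) (snd e) = 2 * quat_cnj (q e) * q (prod.swap e)"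
      using arc_sym[of "fst e" "snd e"] by (simp add: doubly_weighted_entry_def prod.swap_def)
    moreover have "2 * z = z * 2" for z :: quat
      using of_real_quat_commute[of 2 z] by simp
    ultimately show "quat_cnj (x (fst e)) * (doubly_weighted_entry G q (fst e) (snd e) * x (snd e))
        = 2 * (quat_cnj (y e) * y (prod.swap e))"
      by (simp add: y_def mult.assoc)
  qed
  finally have NT: "of_real N * l = 2 * T"
    by (simp add: T_def sum_distrib_left)
  \<comment> \<open>Grouping the arcs by origin and using the normalisation of \<open>q\<close>
    identifies the norms of \<open>x\<close> and \<open>y\<close>.\<close>
  have "N = (\<Sum>u\<in>pverts G. \<Sum>e | e \<in> parcs G \<and> fst e = u. (norm (y e))\<^sup>2)"
  proof -
    have "(\<Sum>e | e \<in> parcs G \<and> fst e = u. (norm (y e))\<^sup>2)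
        = (\<Sum>e | e \<in> parcs G \<and> fst e = u. (norm (q e))\<^sup>2) * (norm (x u))\<^sup>2" for u
      unfolding sum_distrib_right by (rule sum.cong) (auto simp: y_def norm_mult power_mult_distrib)
    then show ?thesis
      by (simp add: N_def q_norm)
  qed
  also have "\<dots> = (\<Sum>e\<in>parcs G. (norm (y e))\<^sup>2)"
    using sub pair_finite_arcs pair_finite_verts by (intro sum.group) auto
  finally have N: "N = (\<Sum>e\<in>parcs G. (norm (y e))\<^sup>2)" .
  \<comment> \<open>Conjugation exchanges the two factors of each term, and arc reversal exchanges
    them back.\<close>
  have "quat_cnj T = (\<Sum>e\<in>parcs G. quat_cnj (y (prod.swap e)) * y e)"
    by (simp add: T_def quat_cnj_sum)
  also have "\<dots> = T"
    unfolding T_def by (subst sum.reindex_bij_betw[OF bij_swap, symmetric]) simp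
  finally have cnjT: "quat_cnj T = T" .
  have "norm T \<le> (\<Sum>e\<in>parcs G. norm (y e) * norm (y (prod.swap e)))"
    unfolding T_def by (rule order_trans[OF norm_sum]) (simp add: norm_mult)
  also have "\<dots> \<le> (\<Sum>e\<in>parcs G. (norm (y e))\<^sup>2 / 2 + (norm (y (prod.swap e)))\<^sup>2 / 2)"
  proof (rule sum_mono)
    fix e
    show "norm (y e) * norm (y (prod.swap e)) \<le> (norm (y e))\<^sup>2 / 2 + (norm (y (prod.swap e)))\<^sup>2 / 2"
      using sum_squares_bound[of "norm (y e)" "norm (y (prod.swap e))"] by simp
  qed
  also have "\<dots> = N / 2 + (\<Sum>e\<in>parcs G. (norm (y (prod.swap e)))\<^sup>2) / 2"
    by (simp add: sum.distrib N sum_divide_distrib)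
  also have "(\<Sum>e\<in>parcs G. (norm (y (prod.swap e)))\<^sup>2) = N"
    unfolding N by (rule sum.reindex_bij_betw[OF bij_swap])
  finally have normT: "norm T \<le> N"
    by simp
  have "N > 0"
    unfolding N_def using nz pair_finite_verts by (auto intro: sum_pos2)
  moreover have "N * norm l = 2 * norm T"
    using arg_cong[OF NT, of norm] \<open>N > 0\<close> by (simp add: norm_mult)
  ultimately show "norm l \<le> 2"
    using normT by (metis mult.commute mult_le_cancel_left_pos mult_left_mono zero_le_numeral)
  have "quat_cnj (2 * T) = 2 * T"
    using of_real_quat_commute[of 2 T] quat_cnj_simps(3)[of 2] by (simp add: cnjT)
  then have "of_real N * quat_cnj l = of_real N * l"
    by (metis NT of_real_quat_commute quat_cnj_simps(3,5))
  then show "quat_cnj l = l"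
    using \<open>N > 0\<close> by simp
qed

lemma Spec_doubly_weighted:
  assumes vs: "distinct vs" "set vs = pverts G"
    and z: "z \<in># Spec (psi (mat_on vs (doubly_weighted_entry G q)))"
  shows "z \<in> \<real> \<and> - 2 \<le> Re z \<and> Re z \<le> 2"
proof -
  have "right_eigenvalue (mat_on vs (doubly_weighted_entry G q)) (quat_of_complex z)"
    using z by (subst right_eigenvalue_complex_iff[of _ "length vs"]) (auto simp: mat_on_def)
  note * = doubly_weighted_right_eigenvalue[OF this vs]
  have "Im z = 0"
    using *(2) by (simp add: quat_eq_iff quat_cnj_def quat_of_complex_def)
  moreover have "norm (quat_of_complex z) = cmod z"
    by (simp add: norm_quat_def inner_quat_def quat_of_complex_def cmod_def power2_eq_square)
  ultimately show ?thesis
    using *(1) abs_Re_le_cmod[of z] by (auto simp: complex_is_Real_iff)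
qed

section \<open>The transition matrix\<close>

text \<open>This is \<open>Spec_coined_walk\<close> applied to the images under \<open>psi\<close>,
  which doubles all sizes; hence the factors 2 in the multiplicities.\<close>

lemma Spec_transition:
  assumes vs: "distinct vs" "set vs = pverts G" and es: "distinct es" "set es = parcs G"
  defines "n \<equiv> 2 * card (pverts G)" and "m \<equiv> 2 * card (edge_set (remove_loops G))"
  shows "Spec (psi (mat_on es (transition_entry q))) + replicate_mset n 1 + replicate_mset (n + m) (- 1)
    = spectral_lift (Spec (psi (mat_on vs (doubly_weighted_entry G q))))
      + replicate_mset m 1 + replicate_mset (2 * card (parcs G)) (- 1)"
proof -
  obtain F where F: "F \<subseteq> parcs G" and anti: "\<And>u v. (u, v) \<in> F \<Longrightarrow> (v, u) \<notin> F"
    and total: "\<And>u v. (u, v) \<in> parcs G \<Longrightarrow> u \<noteq> v \<Longrightarrow> (u, v) \<in> F \<or> (v, u) \<in> F"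
    and cF: "card F = card (edge_set (remove_loops G))"
    by (rule obtain_orientation) blast
  have finF: "finite F"
    using F pair_finite_arcs finite_subset by blast
  obtain fs where fs: "distinct fs" "set fs = F"
    using finite_distinct_list[OF finF] by blast
  define S where "S = rect_mat es es (\<lambda>e f. if f = prod.swap e then 1 else 0 :: quat)"
  \<comment> \<open>In terms of the matrix \<open>K\<close> of the overview, \<open>X = 2 K\<close>
    and \<open>Y = K\<^sup>* S\<close>.\<close>
  define X where "X = rect_mat es vs (\<lambda>e v. if fst e = v then 2 * q e else 0)"
  define Y where "Y = rect_mat vs es (\<lambda>v f. if snd f = v then quat_cnj (q (prod.swap f)) else 0)"
  define c where "c e f = (if e = f then 1 else if e = prod.swap f then - 1 else 0 :: quat)" for e f :: "'v \<times> 'v"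
  \<comment> \<open>the signed incidence matrix of the orientation \<open>F\<close> of the edges of \<open>G'\<close>\<close>
  define R where "R = rect_mat es fs c"
  define R' where "R' = rect_mat fs es (\<lambda>f e. c e f)"
  have carrier: "S \<in> carrier_mat (length es) (length es)" "X \<in> carrier_mat (length es) (length vs)"
    "Y \<in> carrier_mat (length vs) (length es)" "R \<in> carrier_mat (length es) (length fs)"
    "R' \<in> carrier_mat (length fs) (length es)"
    by (simp_all add: S_def X_def Y_def R_def R'_def)
  have S2: "S * S = 1\<^sub>m (length es)"
  proof -
    have "(\<Sum>g\<in>parcs G. (if g = prod.swap e then 1 else 0) * (if f = prod.swap g then 1 else 0))
        = (if e = f then 1 else 0 :: quat)" if "e \<in> parcs G" for e f
      using that pair_finite_arcs
      by (simp add: if_distrib[of "\<lambda>x. x * _"] sum.delta swap_mem_parcs eq_commute cong: if_cong)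
    then have "S * S = rect_mat es es (\<lambda>e f. if e = f then 1 else 0)"
      unfolding S_def rect_mat_mult[OF es(1)] es(2) by (intro rect_mat_cong) (simp add: es)
    then show ?thesis
      using es(1) by (simp add: rect_mat_diagonal) (auto intro!: eq_matI)
  qed
  have U: "mat_on es (transition_entry q) = X * Y - S"
    unfolding X_def Y_def S_def rect_mat_mult[OF vs(1)] rect_mat_minus mat_on_eq_rect_mat vs(2)
  proof (rule rect_mat_cong)
    fix e f assume "e \<in> set es" "f \<in> set es"
    then have "fst e \<in> pverts G"
      by (simp add: es arc_fst_in_verts)
    then have "(\<Sum>v\<in>pverts G. (if fst e = v then 2 * q e else 0)
          * (if snd f = v then quat_cnj (q (prod.swap f)) else 0))
        = (if snd f = fst e then 2 * q e * quat_cnj (q (prod.swap f)) else 0)"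
      using pair_finite_verts by (simp add: if_distrib[of "\<lambda>x. x * _"] sum.delta' cong: if_cong)
    moreover have "of_real (2 * (norm (q e))\<^sup>2 - 1) = 2 * q e * quat_cnj (q e) - 1"
      by (simp add: mult.assoc quat_mult_cnj)
    ultimately show "transition_entry q e f = (\<Sum>v\<in>pverts G. (if fst e = v then 2 * q e else 0)
          * (if snd f = v then quat_cnj (q (prod.swap f)) else 0)) - (if f = prod.swap e then 1 else 0)"
      by (auto simp: transition_entry_def)
  qed
  have W: "mat_on vs (doubly_weighted_entry G q) = Y * X"
    unfolding X_def Y_def rect_mat_mult[OF es(1)] mat_on_eq_rect_mat es(2)
  proof (rule rect_mat_cong)
    fix u v
    have "(\<Sum>e\<in>parcs G. (if snd e = u then quat_cnj (q (prod.swap e)) else 0)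
          * (if fst e = v then 2 * q e else 0))
        = (\<Sum>e\<in>parcs G. if e = (v, u) then 2 * quat_cnj (q (u, v)) * q (v, u) else 0)"
      using of_real_quat_commute[of 2 "quat_cnj (q (u, v))"]
      by (intro sum.cong) (auto simp flip: mult.assoc)
    also have "\<dots> = doubly_weighted_entry G q u v"
      using pair_finite_arcs by (simp add: doubly_weighted_entry_def)
    finally show "doubly_weighted_entry G q u v
      = (\<Sum>e\<in>parcs G. (if snd e = u then quat_cnj (q (prod.swap e)) else 0)
          * (if fst e = v then 2 * q e else 0))" ..
  qed
  \<comment> \<open>Since \<open>S\<close> is an involution, this product is
    \<open>K\<^sup>*\<close>; the normalisation of \<open>q\<close> enters through
    \<open>Y S X = 2 K\<^sup>* K\<close>.\<close>
  have YS: "Y * S = rect_mat vs es (\<lambda>v f. if fst f = v then quat_cnj (q f) else 0)"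
    unfolding Y_def S_def rect_mat_mult[OF es(1)] es(2)
  proof (rule rect_mat_cong)
    fix v f assume "f \<in> set es"
    then have "prod.swap f \<in> parcs G"
      by (simp add: es swap_mem_parcs)
    moreover have "(\<Sum>e\<in>parcs G. (if snd e = v then quat_cnj (q (prod.swap e)) else 0)
          * (if f = prod.swap e then 1 else 0))
        = (\<Sum>e\<in>parcs G. if e = prod.swap f then (if fst f = v then quat_cnj (q f) else 0) else 0)"
      by (intro sum.cong) auto
    ultimately show "(\<Sum>e\<in>parcs G. (if snd e = v then quat_cnj (q (prod.swap e)) else 0)
          * (if f = prod.swap e then 1 else 0)) = (if fst f = v then quat_cnj (q f) else 0)"
      using pair_finite_arcs by simp
  qed
  have YSX: "Y * S * X = of_real 2 \<cdot>\<^sub>m 1\<^sub>m (length vs)"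
  proof -
    have "(\<Sum>e\<in>parcs G. (if fst e = u then quat_cnj (q e) else 0) * (if fst e = v then 2 * q e else 0))
        = (if u = v then of_real 2 else 0)" if "u \<in> pverts G" for u v
    proof -
      have "(\<Sum>e\<in>parcs G. (if fst e = u then quat_cnj (q e) else 0) * (if fst e = v then 2 * q e else 0))
          = (\<Sum>e\<in>parcs G. if fst e = u then (if u = v then of_real (2 * (norm (q e))\<^sup>2) else 0) else 0)"
      proof (rule sum.cong[OF refl])
        fix e
        have "quat_cnj (q e) * (2 * q e) = 2 * (quat_cnj (q e) * q e)"
          using of_real_quat_commute[of 2 "quat_cnj (q e)"] by (simp flip: mult.assoc)
        then show "(if fst e = u then quat_cnj (q e) else 0) * (if fst e = v then 2 * q e else 0)
            = (if fst e = u then (if u = v then of_real (2 * (norm (q e))\<^sup>2) else 0) else 0)"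
          by (auto simp: quat_cnj_mult)
      qed
      also have "\<dots> = (\<Sum>e | e \<in> parcs G \<and> fst e = u. if u = v then of_real (2 * (norm (q e))\<^sup>2) else 0)"
        by (rule sum.inter_filter[symmetric, OF pair_finite_arcs])
      also have "\<dots> = (if u = v then of_real (2 * (\<Sum>e | e \<in> parcs G \<and> fst e = u. (norm (q e))\<^sup>2)) else 0)"
        by (simp add: sum_distrib_left)
      finally show ?thesis
        by (simp only: q_norm[OF that] mult_1_right)
    qed
    then have "Y * S * X = rect_mat vs vs (\<lambda>u v. if u = v then of_real 2 else 0)"
      unfolding YS X_def rect_mat_mult[OF es(1)] es(2) by (intro rect_mat_cong) (simp add: vs)
    then show ?thesis
      using rect_mat_diagonal[OF vs(1), of "of_real 2 :: quat"] by simp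
  qed
  have not_loop: "fst f \<noteq> snd f" "prod.swap f \<notin> F" if "f \<in> F" for f
  proof -
    obtain a b where "f = (a, b)"
      by force
    then show "fst f \<noteq> snd f" "prod.swap f \<notin> F"
      using that anti[of a b] by auto
  qed
  \<comment> \<open>A column of \<open>R\<close> has entries 1 at an arc and -1 at its reverse, and
    distinct edges have disjoint supports.\<close>
  have RR: "R' * R = of_real 2 \<cdot>\<^sub>m 1\<^sub>m (length fs)"
  proof -
    have "(\<Sum>e\<in>parcs G. c e f * c e g) = (if f = g then of_real 2 else 0)" if fg: "f \<in> F" "g \<in> F" for f g
    proof -
      have swap_inj: "prod.swap f = prod.swap g \<longleftrightarrow> f = g"
        by (metis swap_swap)
      have ne: "f \<noteq> prod.swap f" "g \<noteq> prod.swap f" "f \<noteq> prod.swap g"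
        using not_loop(1)[OF fg(1)] not_loop(2)[OF fg(1)] not_loop(2)[OF fg(2)] fg
        by (metis fst_swap, metis, metis)
      have "(\<Sum>e\<in>parcs G. c e f * c e g) = (\<Sum>e\<in>{f, prod.swap f}. c e f * c e g)"
        using fg F swap_mem_parcs[of f]
        by (intro sum.mono_neutral_right pair_finite_arcs) (auto simp: c_def simp del: swap_simp)
      also have "\<dots> = (if f = g then of_real 2 else 0)"
        using ne by (auto simp: c_def swap_inj simp del: swap_simp)
      finally show ?thesis .
    qed
    then have "R' * R = rect_mat fs fs (\<lambda>f g. if f = g then of_real 2 else 0)"
      unfolding R_def R'_def rect_mat_mult[OF es(1)] es(2) by (intro rect_mat_cong) (simp add: fs)
    then show ?thesis
      using rect_mat_diagonal[OF fs(1), of "of_real 2 :: quat"] by simp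
  qed
  \<comment> \<open>On an arc and its reverse, \<open>R R'\<close> has diagonal entries 1 and the
    others -1; at loops it vanishes. Subtracting it from the identity swaps each pair and fixes the
    loops.\<close>
  have SR: "S = 1\<^sub>m (length es) - R * R'"
  proof -
    have "(if f = prod.swap e then 1 else 0) = (if e = f then 1 else 0) - (\<Sum>g\<in>F. c e g * c f g)"
      if ef: "e \<in> parcs G" "f \<in> parcs G" for e f
    proof (cases "fst e = snd e")
      case True
      then have "c e g = 0" if "g \<in> F" for g
        using not_loop(1)[OF that] by (auto simp: c_def)
      then show ?thesis
        using True by (auto simp: prod.swap_def prod_eq_iff)
    next
      case False
      then have "e \<in> F \<or> prod.swap e \<in> F"
        using total[of "fst e" "snd e"] ef(1) by (simp add: prod.swap_def)
      then obtain g where g: "g \<in> F" "e = g \<or> e = prod.swap g"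
        by (metis swap_swap)
      have "c e g' = 0" if "g' \<in> F" "g' \<noteq> g" for g'
      proof -
        have "e \<noteq> g'" "e \<noteq> prod.swap g'"
          using that g not_loop(2)[OF g(1)] not_loop(2)[OF that(1)] by (metis swap_swap)+
        then show ?thesis
          by (simp add: c_def)
      qed
      then have "(\<Sum>g\<in>F. c e g * c f g) = (\<Sum>g\<in>{g}. c e g * c f g)"
        using g by (intro sum.mono_neutral_right finF) auto
      then have sum: "(\<Sum>g\<in>F. c e g * c f g) = c e g * c f g"
        by simp
      have "g \<noteq> prod.swap g"
        using g(1) not_loop(2)[OF g(1)] by metis
      with g(2) show ?thesis
        unfolding sum by (elim disjE) (auto simp: c_def eq_commute[of f] simp del: swap_simp)
    qed
    then have "S = rect_mat es es (\<lambda>e f. if e = f then 1 else 0) - R * R'"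
      unfolding R_def R'_def S_def rect_mat_mult[OF fs(1)] rect_mat_minus fs(2)
      by (intro rect_mat_cong) (simp add: es)
    moreover have "rect_mat es es (\<lambda>e f. if e = f then 1 else 0 :: quat) = 1\<^sub>m (length es)"
      using rect_mat_diagonal[OF es(1), of "1 :: quat"] by (auto intro!: eq_matI)
    ultimately show ?thesis
      by simp
  qed
  have RR'c: "R * R' \<in> carrier_mat (length es) (length es)" and XYc: "X * Y \<in> carrier_mat (length es) (length es)"
    and YSc: "Y * S \<in> carrier_mat (length vs) (length es)"
    using carrier by auto
  have "Spec (psi X * psi Y - psi S) + replicate_mset (length vs + length vs) 1
        + replicate_mset ((length vs + length vs) + (length fs + length fs)) (- 1)
      = spectral_lift (Spec (psi Y * psi X)) + replicate_mset (length fs + length fs) 1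
        + replicate_mset (length es + length es) (- 1)"
  proof (rule Spec_coined_walk[of _ _ _ _ _ "psi R" _ "psi R'"])
    show "psi S * psi S = 1\<^sub>m (length es + length es)"
      using psi_mult[OF carrier(1) carrier(1)] by (simp add: S2 psi_one)
    show "psi Y * psi S * psi X = 2 \<cdot>\<^sub>m 1\<^sub>m (length vs + length vs)"
      using psi_mult[OF carrier(3) carrier(1)] psi_mult[OF YSc carrier(2)] psi_smult_one[of 2 "length vs"]
      by (simp add: YSX)
    show "psi S = 1\<^sub>m (length es + length es) - psi R * psi R'"
      using psi_mult[OF carrier(4,5)] psi_minus[OF one_carrier_mat RR'c] SR by (simp add: psi_one)
    show "psi R' * psi R = 2 \<cdot>\<^sub>m 1\<^sub>m (length fs + length fs)"
      using psi_mult[OF carrier(5,4)] psi_smult_one[of 2 "length fs"] by (simp add: RR)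
  qed (use carrier in auto)
  moreover have "psi (X * Y - S) = psi X * psi Y - psi S"
    using psi_minus[OF XYc carrier(1)] psi_mult[OF carrier(2,3)] by simp
  moreover have "psi (Y * X) = psi Y * psi X"
    by (rule psi_mult[OF carrier(3,2)])
  moreover have "length vs = card (pverts G)" "length es = card (parcs G)" "length fs = card F"
    using distinct_card[OF vs(1)] distinct_card[OF es(1)] distinct_card[OF fs(1)]
    by (simp_all add: vs es fs)
  ultimately show ?thesis
    by (simp add: U W n_def m_def cF mult_2)
qed

end

section \<open>The three cases, the conjugate pairs and the right spectrum\<close>

theorem theorem5p2:
  fixes G :: "'v pair_pre_digraph"
    and q :: "'v \<times> 'v \<Rightarrow> quat"
    and vs :: "'v list" and es :: "('v \<times> 'v) list"
    and n m0 m1 m' :: nat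
    and W U :: "quat mat"
    and \<Lambda> :: "complex multiset"
  defines "n \<equiv> card (pverts G)"
    and "m1 \<equiv> card (loop_set G)"
    and "m0 \<equiv> card (edge_set G) - m1"
    and "m' \<equiv> 2 * m0 + m1"
    and "W \<equiv> mat_on vs (doubly_weighted_entry G q)"
    and "U \<equiv> mat_on es (transition_entry q)"
    and "\<Lambda> \<equiv> spectral_lift (Spec (psi W))"
  assumes graph: "pair_pseudo_graph G"
    and conn: "connected (with_proj G)"
    and vs: "distinct vs" "set vs = pverts G"
    and es: "distinct es" "set es = parcs G"
    and q_nz: "\<And>e. e \<in> parcs G \<Longrightarrow> q e \<noteq> 0"
    and q_norm: "\<And>u. u \<in> pverts G \<Longrightarrow> (\<Sum>e | e \<in> parcs G \<and> fst e = u. (norm (q e))\<^sup>2) = 1"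
  shows "m' = card (parcs G) \<and>
    (\<forall>\<mu> \<in># Spec (psi W). \<mu> \<in> \<real> \<and> - 2 \<le> Re \<mu> \<and> Re \<mu> \<le> 2) \<and>
    size \<Lambda> = 4 * n \<and>
    size (Spec (psi U)) = 2 * m' \<and>
    (\<not> undirected_tree (remove_loops G) \<longrightarrow>
       n \<le> m0 \<and>
       Spec (psi U) = \<Lambda> + replicate_mset (2 * m0 - 2 * n) 1
                        + replicate_mset (2 * m0 + 2 * m1 - 2 * n) (- 1)) \<and>
    (undirected_tree (remove_loops G) \<and> loop_set G = {} \<longrightarrow>
       {#1, 1, - 1, - 1#} \<subseteq># \<Lambda> \<and>
       Spec (psi U) = \<Lambda> - {#1, 1, - 1, - 1#}) \<and>
    (undirected_tree (remove_loops G) \<and> loop_set G \<noteq> {} \<longrightarrow>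
       {#1, 1#} \<subseteq># \<Lambda> \<and>
       Spec (psi U) = (\<Lambda> - {#1, 1#}) + replicate_mset (2 * m1 - 2) (- 1)) \<and>
    (\<exists>ls. length ls = m' \<and> Spec (psi U) = mset ls + mset (map cnj ls)) \<and>
    (\<forall>ls. length ls = m' \<and> Spec (psi U) = mset ls + mset (map cnj ls) \<longrightarrow>
       right_spectrum U = (\<Union>r<m'. quat_class (quat_of_complex (ls ! r))))"
proof -
  interpret szegedy_walk G q
    using graph q_norm by (simp add: szegedy_walk_def szegedy_walk_axioms_def)
  interpret H: pair_graph "remove_loops G"
    by (rule pair_graph_remove_loops)
  have H: "pverts (remove_loops G) = pverts G"
    by (simp add: remove_loops_def)
  obtain F :: "('v \<times> 'v) set" where "card F = card (edge_set (remove_loops G))"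
    and "card (parcs G) = 2 * card F + card (loop_set G)"
    and "card (edge_set G) = card F + card (loop_set G)"
    by (rule obtain_orientation) blast
  then have m0: "card (edge_set (remove_loops G)) = m0" and m': "m' = card (parcs G)"
    by (simp_all add: m'_def m0_def m1_def)
  have W: "psi W \<in> carrier_mat (2 * n) (2 * n)" and U: "U \<in> carrier_mat m' m'"
    using distinct_card[OF vs(1)] distinct_card[OF es(1)]
    by (auto simp: W_def U_def mat_on_def n_def m' vs es mult_2 intro!: psi_carrier)
  have real: "\<forall>\<mu>\<in>#Spec (psi W). \<mu> \<in> \<real> \<and> - 2 \<le> Re \<mu> \<and> Re \<mu> \<le> 2"
    using Spec_doubly_weighted[OF vs] by (auto simp: W_def)
  have size_L: "size \<Lambda> = 4 * n"
    by (simp add: \<Lambda>_def size_spectral_lift size_Spec[OF W])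
  have size_U: "size (Spec (psi U)) = 2 * m'"
    using size_Spec[OF psi_carrier[OF U]] by simp
  have key: "Spec (psi U) + replicate_mset (2 * n) 1 + replicate_mset (2 * n + 2 * m0) (- 1)
      = \<Lambda> + replicate_mset (2 * m0) 1 + replicate_mset (2 * m') (- 1)"
    using Spec_transition[OF vs es] by (simp add: U_def \<Lambda>_def W_def n_def m0 m')
  have conn': "connected (with_proj (remove_loops G))"
    by (rule connected_remove_loops[OF conn])
  note tree = H.undirected_tree_iff[OF conn', unfolded H m0 n_def[symmetric]]
  have rep: "replicate_mset (a + b) x = replicate_mset a x + replicate_mset b x" for a b and x :: complex
    by (induction a) auto
  have not_tree: "n \<le> m0 \<and> Spec (psi U) = \<Lambda> + replicate_mset (2 * m0 - 2 * n) 1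
      + replicate_mset (2 * m0 + 2 * m1 - 2 * n) (- 1)" if "\<not> undirected_tree (remove_loops G)"
  proof -
    have le: "n \<le> m0"
      using that tree by simp
    \<comment> \<open>By \<open>n \<le> m0\<close> the subtractions of natural numbers are exact, so
      each multiplicity on the right splits into the one to be cancelled and a remainder.\<close>
    then have "2 * m0 = 2 * n + (2 * m0 - 2 * n)"
      "2 * m' = 2 * n + 2 * m0 + (2 * m0 + 2 * m1 - 2 * n)"
      by (simp_all add: m'_def)
    then have "replicate_mset (2 * m0) 1 = replicate_mset (2 * n) 1 + replicate_mset (2 * m0 - 2 * n) (1 :: complex)"
      "replicate_mset (2 * m') (- 1) = replicate_mset (2 * n + 2 * m0) (- 1)
        + replicate_mset (2 * m0 + 2 * m1 - 2 * n) (- 1 :: complex)"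
      by (metis rep)+
    with key le show ?thesis
      by (simp only: ac_simps add_left_cancel add_right_cancel) (simp add: add.assoc[symmetric])
  qed
  have is_tree: "Spec (psi U) + {#1, 1, - 1, - 1#} = \<Lambda> + replicate_mset (2 * m1) (- 1)"
    if "undirected_tree (remove_loops G)"
  proof -
    \<comment> \<open>The surplus of one vertex over the edges of the tree is the source of the
      extra pairs of 1 and -1.\<close>
    have n: "n = m0 + 1"
      using that tree by simp
    have "replicate_mset (2 * n) 1 = replicate_mset (2 * m0) 1 + {#1, 1 :: complex#}"
      "replicate_mset (2 * n + 2 * m0) (- 1) = replicate_mset (4 * m0) (- 1) + {#- 1, - 1 :: complex#}"
      "replicate_mset (2 * m') (- 1) = replicate_mset (4 * m0) (- 1) + replicate_mset (2 * m1) (- 1 :: complex)"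
      by (simp_all add: n m'_def flip: rep)
    then have "Spec (psi U) + {#1, 1, - 1, - 1#} + (replicate_mset (2 * m0) 1 + replicate_mset (4 * m0) (- 1))
      = \<Lambda> + replicate_mset (2 * m1) (- 1) + (replicate_mset (2 * m0) 1 + replicate_mset (4 * m0) (- 1))"
      using key by (simp add: ac_simps add_mset_commute)
    then show ?thesis
      by (simp only: add_right_cancel)
  qed
  have tree_no_loop: "{#1, 1, - 1, - 1#} \<subseteq># \<Lambda> \<and> Spec (psi U) = \<Lambda> - {#1, 1, - 1, - 1#}"
    if "undirected_tree (remove_loops G)" "loop_set G = {}"
  proof -
    have "m1 = 0"
      using that by (simp add: m1_def)
    then have "\<Lambda> = Spec (psi U) + {#1, 1, - 1, - 1#}"
      using is_tree[OF that(1)] by simp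
    then show ?thesis
      by (metis add_diff_cancel_right' mset_subset_eq_add_right)
  qed
  have tree_loop: "{#1, 1#} \<subseteq># \<Lambda> \<and> Spec (psi U) = \<Lambda> - {#1, 1#} + replicate_mset (2 * m1 - 2) (- 1)"
    if "undirected_tree (remove_loops G)" "loop_set G \<noteq> {}"
  proof -
    have "finite (loop_set G)"
      by (rule finite_subset[OF _ finite_edge_set]) (auto simp: loop_set_def edge_set_def)
    \<comment> \<open>A loop exists, so \<open>m1\<close> is positive and the subtraction does not
      truncate.\<close>
    then have "2 * m1 = (2 * m1 - 2) + 2"
      using that(2) card_gt_0_iff[of "loop_set G"] by (simp add: m1_def)
    then have "replicate_mset (2 * m1) (- 1) = replicate_mset (2 * m1 - 2) (- 1) + replicate_mset 2 (- 1 :: complex)"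
      by (metis rep)
    then have "replicate_mset (2 * m1) (- 1) = replicate_mset (2 * m1 - 2) (- 1) + {#- 1, - 1 :: complex#}"
      by (simp add: numeral_2_eq_2)
    then have "Spec (psi U) + {#1, 1#} + {#- 1, - 1#}
        = \<Lambda> + replicate_mset (2 * m1 - 2) (- 1) + {#- 1, - 1#}"
      using is_tree[OF that(1)] by (simp add: ac_simps)
    then have eq: "Spec (psi U) + {#1, 1#} = \<Lambda> + replicate_mset (2 * m1 - 2) (- 1)"
      by (simp only: add_right_cancel)
    \<comment> \<open>The padding on the right consists of copies of -1 only, so both copies of 1
      must come from \<Lambda>.\<close>
    have "count {#1, 1#} x \<le> count \<Lambda> x" for x :: complex
      using arg_cong[OF eq, of "\<lambda>M. count M 1"] by (simp add: one_neq_neg_one)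
    then have sub: "{#1, 1#} \<subseteq># \<Lambda>"
      by (rule mset_subset_eqI)
    then have "Spec (psi U) + {#1, 1#} = \<Lambda> - {#1, 1#} + replicate_mset (2 * m1 - 2) (- 1) + {#1, 1#}"
      unfolding eq by (metis add.assoc add.commute subset_mset.diff_add)
    with sub show ?thesis
      by (simp only: add_right_cancel)
  qed
  have pairs: "\<exists>ls. length ls = m' \<and> Spec (psi U) = mset ls + mset (map cnj ls)"
  proof -
    obtain L where "\<Lambda> = L + image_mset cnj L"
      using spectral_lift_conj_pairs real unfolding \<Lambda>_def by blast
    \<comment> \<open>The added elements are real and occur an even number of times:
      \<open>A\<close> and \<open>B\<close> take half of them, and conjugation supplies the other
      half.\<close>
    define A where "A = replicate_mset n 1 + replicate_mset (n + m0) (- 1 :: complex)"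
    define B where "B = L + replicate_mset m0 1 + replicate_mset m' (- 1 :: complex)"
    have "Spec (psi U) + (A + image_mset cnj A) = B + image_mset cnj B"
      using key unfolding A_def B_def \<open>\<Lambda> = L + image_mset cnj L\<close> rep mult_2
      by (simp add: ac_simps)
    then obtain N where N: "Spec (psi U) = N + image_mset cnj N"
      using conj_pairs_cancel by blast
    obtain ls where "mset ls = N"
      using ex_mset by blast
    with N have "Spec (psi U) = mset ls + mset (map cnj ls)"
      by simp
    moreover from this have "length ls = m'"
      using size_U by simp
    ultimately show ?thesis
      by blast
  qed
  have "right_spectrum U = (\<Union>r<m'. quat_class (quat_of_complex (ls ! r)))"
    if "length ls = m'" "Spec (psi U) = mset ls + mset (map cnj ls)" for ls
  proof -
    have "right_spectrum U = (\<Union>z\<in>set ls. quat_class (quat_of_complex z))"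
      by (simp add: right_spectrum_eq[OF U] that(2) quat_class_cnj)
    also have "set ls = (!) ls ` {..<m'}"
      using that(1) by (auto simp: set_conv_nth)
    finally show ?thesis
      by simp
  qed
  then show ?thesis
    using m' real size_L size_U not_tree tree_no_loop tree_loop pairs by blast
qed

end
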